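(* Let $T=T_0+1$. Suppose (autoregressive model with covariates) that for each $i=1,\dots,N$, $$Y^N_{iT}(x)=\sum_{t=1}^{T_0}\langle\beta_t(x,\cdot),Y^N_{it}\rangle_{\mathcal H}+\sum_{\ell=1}^p\eta_\ell(x)Z_{i\ell}+\varepsilon_{iT}(x),\qquad x\in\mathcal X,$$ with $\beta_t\in L^2(\mathcal X\times\mathcal X,\mu\otimes\mu)$, $\eta_\ell\in\mathcal H$, and $\varepsilon_{1T},\dots,\varepsilon_{NT}$ independent mean-zero $\mathcal H$-valued random elements with $\|\varepsilon_{iT}\|_{\mathcal H}\le\sigma$ a.s. The pre-treatment outcomes and covariates are treated as fixed, and $\hat\gamma\in\mathbb R^{N-1}$ with $\sum_{i=2}^N\hat\gamma_i=1$ is a fixed weight vector. Let $\hat\nu^N_{1T}$ be the generic weighting estimator built from $\hat\gamma$. Then for any $\delta>0$, with probability at least $1-2e^{-\delta^2/2}$, $$d(\nu^N_{1T},\hat\nu^N_{1T})\le\sqrt{\sum_{t=1}^{T_0}\|\beta_t\|^2_{\mathcal H\times\mathcal H}}\sqrt{\sum_{t=1}^{T_0}\Big\|Y_{1t}-\sum_{i=2}^N\hat\gamma_iY_{it}\Big\|^2_{\mathcal H}}+\sqrt{\sum_{\ell=1}^p\|\eta_\ell\|^2_{\mathcal H}}\,\Big\|Z_1-\sum_{i=2}^N\hat\gamma_iZ_i\Big\|_2+\delta\sigma(1+\|\hat\gamma\|_2).$$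
   Context: Let $(\mathcal X,\mathcal A,\mu)$ be either a compact interval $\mathcal I\subset\mathbb R$ with Lebesgue measure or the finite set $\{1,\dots,d\}$ with counting measure, and let $\mathcal H=L^2(\mathcal X,\mathcal A,\mu)$ (so $\mathcal H=L^2(\mathcal I)$ or $\mathcal H=\mathbb R^d$), with inner product $\langle f,g\rangle_{\mathcal H}=\int_{\mathcal X}fg\,d\mu$ and norm $\|\cdot\|_{\mathcal H}$. $(\mathcal M,d)$ is a metric space and $\Psi:\mathcal M\to\mathcal H$ is an isometry, $d(a,b)=\|\Psi(a)-\Psi(b)\|_{\mathcal H}$; its image $\mathcal Y=\Psi(\mathcal M)$ is nonempty, closed and convex in $\mathcal H$. Panel setting: units $i=1,\dots,N$, periods $t=1,\dots,T$, $1\le T_0<T$; transformed control potential outcomes $Y^N_{it}\in\mathcal Y$ and observed outcomes $Y_{it}\in\mathcal Y$ with $Y_{it}=Y^N_{it}$ whenever $i\ge2$ or $t\le T_0$; the counterfactual of interest is $\nu^N_{1T}=\Psi^{-1}(Y^N_{1T})$. Each unit has covariates $Z_i=(Z_{i1},\dots,Z_{ip})'\in\mathbb R^p$. Generic weighting estimator: given weights $\hat\gamma\in\mathbb R^{N-1}$ with $\sum_{i=2}^N\hat\gamma_i=1$ not depending on the post-treatment outcomes, set $\hat Y^N_{1T}=\sum_{i=2}^N\hat\gamma_iY_{iT}$, $\tilde Y^N_{1T}=\arg\min_{y\in\mathcal Y}\|y-\hat Y^N_{1T}\|_{\mathcal H}$, and $\hat\nu^N_{1T}=\Psi^{-1}(\tilde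 Y^N_{1T})$. For $\beta\in L^2(\mathcal X\times\mathcal X)$, $\|\beta\|_{\mathcal H\times\mathcal H}=\big(\int\int\beta(x,y)^2\,d\mu(x)d\mu(y)\big)^{1/2}$. *)

theory Defs
  imports "HOL-Probability.Probability"
begin

text \<open>The Hilbert space H = L2(X, mu), represented by square-integrable functions
  (elements are compared up to mu-a.e. equality through the seminorm).\<close>

definition L2 :: "'x measure \<Rightarrow> ('x \<Rightarrow> real) set" where
  "L2 \<mu> = {f. f \<in> borel_measurable \<mu> \<and> integrable \<mu> (\<lambda>x. (f x)\<^sup>2)}"

definition l2_inner :: "'x measure \<Rightarrow> ('x \<Rightarrow> real) \<Rightarrow> ('x \<Rightarrow> real) \<Rightarrow> real" where
  "l2_inner \<mu> f g = (\<integral>x. f x * g x \<partial>\<mu>)"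

definition l2_norm :: "'x measure \<Rightarrow> ('x \<Rightarrow> real) \<Rightarrow> real" where
  "l2_norm \<mu> f = sqrt (\<integral>x. (f x)\<^sup>2 \<partial>\<mu>)"

definition L2_kernel :: "'x measure \<Rightarrow> ('x \<Rightarrow> 'x \<Rightarrow> real) set" where
  "L2_kernel \<mu> = {\<beta>. case_prod \<beta> \<in> borel_measurable (\<mu> \<Otimes>\<^sub>M \<mu>)
                     \<and> integrable (\<mu> \<Otimes>\<^sub>M \<mu>) (\<lambda>(x, y). (\<beta> x y)\<^sup>2)}"

definition hs_norm :: "'x measure \<Rightarrow> ('x \<Rightarrow> 'x \<Rightarrow> real) \<Rightarrow> real" where
  "hs_norm \<mu> \<beta> = sqrt (\<integral>x. (\<integral>y. (\<beta> x y)\<^sup>2 \<partial>\<mu>) \<partial>\<mu>)"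

text \<open>Closedness and convexity of a subset of H (in the quotient sense: up to a.e. equality).\<close>

definition l2_closed :: "'x measure \<Rightarrow> ('x \<Rightarrow> real) set \<Rightarrow> bool" where
  "l2_closed \<mu> S \<longleftrightarrow> (\<forall>y s. y \<in> L2 \<mu> \<and> (\<forall>n. s n \<in> S) \<and>
        (\<lambda>n. l2_norm \<mu> (\<lambda>x. s n x - y x)) \<longlonglongrightarrow> 0
        \<longrightarrow> (\<exists>z\<in>S. l2_norm \<mu> (\<lambda>x. y x - z x) = 0))"

definition l2_convex :: "'x measure \<Rightarrow> ('x \<Rightarrow> real) set \<Rightarrow> bool" where
  "l2_convex \<mu> S \<longleftrightarrow> (\<forall>y1\<in>S. \<forall>y2\<in>S. \<forall>u::real. 0 \<le> u \<and> u \<le> 1 \<longrightarrow>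
        (\<exists>z\<in>S. l2_norm \<mu> (\<lambda>x. (1 - u) * y1 x + u * y2 x - z x) = 0))"

definition l2_proj :: "'x measure \<Rightarrow> ('x \<Rightarrow> real) set \<Rightarrow> ('x \<Rightarrow> real) \<Rightarrow> ('x \<Rightarrow> real)" where
  "l2_proj \<mu> S h = (SOME y. y \<in> S \<and> (\<forall>z\<in>S. l2_norm \<mu> (\<lambda>x. y x - h x) \<le> l2_norm \<mu> (\<lambda>x. z x - h x)))"

definition weighting_estimator ::
  "'x measure \<Rightarrow> ('m \<Rightarrow> 'x \<Rightarrow> real) \<Rightarrow> nat \<Rightarrow> (nat \<Rightarrow> real) \<Rightarrow> (nat \<Rightarrow> 'x \<Rightarrow> real) \<Rightarrow> 'm" where
  "weighting_estimator \<mu> \<Psi> N \<gamma> YT =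
     inv \<Psi> (l2_proj \<mu> (range \<Psi>) (\<lambda>x. \<Sum>i\<in>{2..N}. \<gamma> i * YT i x))"

end

theory Submission
  imports Defs
begin

text \<open>Put \<open>w 1 = 1\<close> and \<open>w i = - \<gamma> i\<close> otherwise. Projecting onto a closed convex set does not increase
  the distance to a point of that set, so the error is at most the norm of \<open>\<Sum>i. w i * Y i\<close>, which by
  the model is a kernel term plus a covariate term plus \<open>\<Sum>i. w i * \<epsilon> i\<close>. The first two are
  bounded by Cauchy-Schwarz. For the noise, the function \<open>s \<mapsto> cosh (l * sqrt s)\<close> is convex, whence
  \<open>E (cosh (l * norm (x + d))) \<le> cosh (l * norm x) * cosh (l * c)\<close> for every centred \<open>d\<close> with
  \<open>norm d \<le> c\<close>; iterating over the independent summands and applying Markov's inequality gives Pinelis'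
  tail bound \<open>2 * exp (- \<delta>\<^sup>2 / 2)\<close> at level \<open>\<delta> * \<sigma> * sqrt (\<Sum>i. (w i)\<^sup>2)\<close>. The iteration is carried
  out for coordinates with respect to finite orthonormal systems, whose Bessel sums exhaust the norm.\<close>

section \<open>The seminormed space of square-integrable functions\<close>

text \<open>Elements of \<open>L2\<close> are functions with a seminorm, so closedness and convexity
  of the image supply points only up to norm zero, and the noise is accessible only through its
  coordinates. Each expectation therefore involves finitely many coordinates, and the tail bound
  must be free of dimension to survive the passage to the limit. The function \<open>cosh\<close> is
  used because \<open>exp (l * sqrt s)\<close> fails to be convex near \<open>s = 0\<close>, whereas
  the series of \<open>cosh (l * sqrt s)\<close> has only integer powers of \<open>s\<close>. The
  convexity is used along the cross term of \<open>x\<close> and \<open>d\<close>: at the extremes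
  allowed by Cauchy-Schwarz the values are \<open>cosh (l * (norm x - c))\<close> and
  \<open>cosh (l * (norm x + c))\<close>, whose mean is
  \<open>cosh (l * norm x) * cosh (l * c)\<close>. The price of \<open>cosh\<close> is the factor 2,
  from \<open>cosh t \<ge> exp t / 2\<close>. The orthonormal systems for different \<open>n\<close>
  may be unrelated: it is enough that their spans eventually approximate each function, so on an
  interval the normalised indicators of equal cells suffice.\<close>

lemma L2_measurable: "f \<in> L2 \<mu> \<Longrightarrow> f \<in> borel_measurable \<mu>"
  and L2_integrable_square: "f \<in> L2 \<mu> \<Longrightarrow> integrable \<mu> (\<lambda>x. (f x)\<^sup>2)"
  by (auto simp: L2_def)

lemma L2_integrable_mult:
  assumes "f \<in> L2 \<mu>" "g \<in> L2 \<mu>"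
  shows "integrable \<mu> (\<lambda>x. f x * g x)"
proof (rule Bochner_Integration.integrable_bound)
  show "integrable \<mu> (\<lambda>x. (f x)\<^sup>2 + (g x)\<^sup>2)"
    using assms by (intro Bochner_Integration.integrable_add L2_integrable_square)
  show "(\<lambda>x. f x * g x) \<in> borel_measurable \<mu>"
    using assms by (intro borel_measurable_times L2_measurable)
  have "\<bar>a * b\<bar> \<le> a\<^sup>2 + b\<^sup>2" for a b :: real
  proof -
    have "2 * (\<bar>a\<bar> * \<bar>b\<bar>) \<le> a\<^sup>2 + b\<^sup>2"
      using sum_squares_bound[of "\<bar>a\<bar>" "\<bar>b\<bar>"] by (simp add: algebra_simps)
    then show ?thesis
      unfolding abs_mult using mult_nonneg_nonneg[of "\<bar>a\<bar>" "\<bar>b\<bar>"] by linarith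
  qed
  then show "AE x in \<mu>. norm (f x * g x) \<le> norm ((f x)\<^sup>2 + (g x)\<^sup>2)"
    by simp
qed

lemma L2_zero: "(\<lambda>_. 0) \<in> L2 \<mu>"
  by (simp add: L2_def)

lemma L2_cmult: "f \<in> L2 \<mu> \<Longrightarrow> (\<lambda>x. c * f x) \<in> L2 \<mu>"
  by (auto simp: L2_def power_mult_distrib)

lemma L2_add:
  assumes "f \<in> L2 \<mu>" "g \<in> L2 \<mu>"
  shows "(\<lambda>x. f x + g x) \<in> L2 \<mu>"
  using assms L2_integrable_mult[OF assms] by (auto simp: L2_def power2_sum mult.assoc)

lemma L2_diff:
  assumes "f \<in> L2 \<mu>" "g \<in> L2 \<mu>"
  shows "(\<lambda>x. f x - g x) \<in> L2 \<mu>"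
  using L2_add[OF assms(1) L2_cmult[OF assms(2), of "-1"]] by simp

lemma L2_sum: "(\<And>i. i \<in> I \<Longrightarrow> f i \<in> L2 \<mu>) \<Longrightarrow> (\<lambda>x. \<Sum>i\<in>I. f i x) \<in> L2 \<mu>"
  by (induction I rule: infinite_finite_induct) (auto intro: L2_zero L2_add)

lemma L2_bounded:
  fixes f :: "'x \<Rightarrow> real"
  assumes "finite_measure \<mu>" "f \<in> borel_measurable \<mu>" "AE x in \<mu>. \<bar>f x\<bar> \<le> B"
  shows "f \<in> L2 \<mu>"
proof -
  interpret finite_measure \<mu> by fact
  have "AE x in \<mu>. norm ((f x)\<^sup>2) \<le> B\<^sup>2"
    using assms(3) by eventually_elim (metis abs_ge_zero norm_power power_mono real_norm_def)
  then have "integrable \<mu> (\<lambda>x. (f x)\<^sup>2)"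
    using assms(2) by (intro integrable_const_bound) auto
  then show ?thesis using assms(2) by (simp add: L2_def)
qed

lemma l2_inner_commute: "l2_inner \<mu> f g = l2_inner \<mu> g f"
  by (simp add: l2_inner_def mult.commute)

lemma l2_inner_cmult_left: "l2_inner \<mu> (\<lambda>x. c * f x) g = c * l2_inner \<mu> f g"
  by (simp add: l2_inner_def mult.assoc)

lemma l2_inner_sum_left:
  assumes "\<And>i. i \<in> I \<Longrightarrow> f i \<in> L2 \<mu>" "h \<in> L2 \<mu>"
  shows "l2_inner \<mu> (\<lambda>x. \<Sum>i\<in>I. f i x) h = (\<Sum>i\<in>I. l2_inner \<mu> (f i) h)"
  using assms
  by (simp add: l2_inner_def sum_distrib_right L2_integrable_mult Bochner_Integration.integral_sum)

lemma l2_norm_nonneg: "0 \<le> l2_norm \<mu> f"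
  by (simp add: l2_norm_def)

lemma l2_norm_square: "(l2_norm \<mu> f)\<^sup>2 = l2_inner \<mu> f f"
  by (simp add: l2_norm_def l2_inner_def power2_eq_square)

lemma l2_norm_cong_AE:
  assumes "f \<in> borel_measurable \<mu>" "g \<in> borel_measurable \<mu>" "AE x in \<mu>. f x = g x"
  shows "l2_norm \<mu> f = l2_norm \<mu> g"
  unfolding l2_norm_def using assms by (intro arg_cong[where f = sqrt] integral_cong_AE) auto

lemma l2_norm_cmult: "l2_norm \<mu> (\<lambda>x. c * f x) = \<bar>c\<bar> * l2_norm \<mu> f"
  by (simp add: l2_norm_def power_mult_distrib real_sqrt_mult)

lemma l2_norm_minus_commute: "l2_norm \<mu> (\<lambda>x. f x - g x) = l2_norm \<mu> (\<lambda>x. g x - f x)"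
  by (simp add: l2_norm_def power2_commute)

lemma l2_norm_add_square:
  assumes "f \<in> L2 \<mu>" "g \<in> L2 \<mu>"
  shows "(l2_norm \<mu> (\<lambda>x. f x + g x))\<^sup>2 = (l2_norm \<mu> f)\<^sup>2 + 2 * l2_inner \<mu> f g + (l2_norm \<mu> g)\<^sup>2"
proof -
  have "l2_inner \<mu> (\<lambda>x. f x + g x) (\<lambda>x. f x + g x) =
      (\<integral>x. (f x * f x + 2 * (f x * g x)) + g x * g x \<partial>\<mu>)"
    unfolding l2_inner_def by (intro Bochner_Integration.integral_cong) (auto simp: algebra_simps)
  also have "\<dots> = l2_inner \<mu> f f + 2 * l2_inner \<mu> f g + l2_inner \<mu> g g"
    unfolding l2_inner_def using assms
    by (simp add: L2_integrable_mult)
  finally show ?thesis by (simp add: l2_norm_square)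
qed

lemma l2_norm_diff_square:
  assumes "f \<in> L2 \<mu>" "g \<in> L2 \<mu>"
  shows "(l2_norm \<mu> (\<lambda>x. f x - g x))\<^sup>2 = (l2_norm \<mu> f)\<^sup>2 - 2 * l2_inner \<mu> f g + (l2_norm \<mu> g)\<^sup>2"
  using l2_norm_add_square[OF assms(1) L2_cmult[OF assms(2), of "-1"]]
  by (simp add: l2_norm_cmult[of _ "-1", simplified] l2_inner_cmult_left[of _ "-1" g, simplified]
      l2_inner_commute[of _ f])

lemma l2_Cauchy_Schwarz:
  assumes "f \<in> L2 \<mu>" "g \<in> L2 \<mu>"
  shows "\<bar>l2_inner \<mu> f g\<bar> \<le> l2_norm \<mu> f * l2_norm \<mu> g"
proof -
  let ?a = "l2_norm \<mu> f" and ?b = "l2_norm \<mu> g" and ?i = "l2_inner \<mu> f g"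
  have q: "0 \<le> ?a\<^sup>2 + 2 * t * ?i + t\<^sup>2 * ?b\<^sup>2" for t
    using zero_le_power2[of "l2_norm \<mu> (\<lambda>x. f x + t * g x)"]
    unfolding l2_norm_add_square[OF assms(1) L2_cmult[OF assms(2)]] l2_norm_cmult
      l2_inner_commute[of _ f] l2_inner_cmult_left
    by (simp add: power_mult_distrib mult.assoc)
  have "?i\<^sup>2 \<le> ?a\<^sup>2 * ?b\<^sup>2"
  proof (cases "?b = 0")
    case True
    have "?i = 0"
    proof (rule ccontr)
      assume "?i \<noteq> 0"
      \<comment> \<open>With \<open>?b = 0\<close> the quadratic \<open>q\<close> is affine in
        \<open>t\<close> with slope \<open>2 * ?i\<close>; at this \<open>t\<close> it would equal
        -1.\<close>
      with q[of "- (?a\<^sup>2 + 1) / (2 * ?i)"] True show False by (simp add: field_simps)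
    qed
    then show ?thesis by simp
  next
    case False
    then have b: "0 < ?b\<^sup>2" by simp
    \<comment> \<open>The value \<open>- ?i / ?b\<^sup>2\<close> is the minimiser of the quadratic
      \<open>q\<close>.\<close>
    have "0 \<le> ?b\<^sup>2 * (?a\<^sup>2 + 2 * (- ?i / ?b\<^sup>2) * ?i + (- ?i / ?b\<^sup>2)\<^sup>2 * ?b\<^sup>2)"
      using q[of "- ?i / ?b\<^sup>2"] b by (intro mult_nonneg_nonneg) auto
    also have "\<dots> = ?a\<^sup>2 * ?b\<^sup>2 - ?i\<^sup>2"
      using False by (simp add: field_simps power2_eq_square)
    finally show ?thesis by simp
  qed
  then have "\<bar>?i\<bar>\<^sup>2 \<le> (?a * ?b)\<^sup>2" by (simp add: power_mult_distrib)
  then show ?thesis by (rule power2_le_imp_le) (simp add: l2_norm_nonneg)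
qed

lemma l2_norm_triangle:
  assumes "f \<in> L2 \<mu>" "g \<in> L2 \<mu>"
  shows "l2_norm \<mu> (\<lambda>x. f x + g x) \<le> l2_norm \<mu> f + l2_norm \<mu> g"
proof (rule power2_le_imp_le)
  show "(l2_norm \<mu> (\<lambda>x. f x + g x))\<^sup>2 \<le> (l2_norm \<mu> f + l2_norm \<mu> g)\<^sup>2"
    using l2_Cauchy_Schwarz[OF assms] by (simp add: l2_norm_add_square[OF assms] power2_sum)
qed (simp add: l2_norm_nonneg)

lemma l2_norm_triangle_diff:
  assumes "f \<in> L2 \<mu>" "g \<in> L2 \<mu>" "h \<in> L2 \<mu>"
  shows "l2_norm \<mu> (\<lambda>x. f x - h x) \<le> l2_norm \<mu> (\<lambda>x. f x - g x) + l2_norm \<mu> (\<lambda>x. g x - h x)"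
  using l2_norm_triangle[OF L2_diff[OF assms(1,2)] L2_diff[OF assms(2,3)]] by simp

lemma AE_eq_if_l2_norm_zero:
  assumes "f \<in> L2 \<mu>" "l2_norm \<mu> f = 0"
  shows "AE x in \<mu>. f x = 0"
  using assms integral_nonneg_eq_0_iff_AE[OF L2_integrable_square[OF assms(1)]]
  by (auto simp: l2_norm_def)

section \<open>Completeness and projection onto closed convex sets\<close>

text \<open>Riesz-Fischer for a geometric rate. On a finite measure the L1 norm is at most a
  constant times the L2 norm, so the increments form an a.e. absolutely convergent series; this
  yields a pointwise limit, and Fatou's lemma turns the Cauchy rate into norm convergence.\<close>

lemma L2_complete:
  fixes s :: "nat \<Rightarrow> 'x \<Rightarrow> real"
  assumes "finite_measure \<mu>" and s: "\<And>n. s n \<in> L2 \<mu>"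
    and fast: "\<And>n m. n \<le> m \<Longrightarrow> l2_norm \<mu> (\<lambda>x. s n x - s m x) \<le> (1/2) ^ n"
  obtains y where "y \<in> L2 \<mu>" "(\<lambda>n. l2_norm \<mu> (\<lambda>x. s n x - y x)) \<longlonglongrightarrow> 0"
proof -
  interpret finite_measure \<mu> by fact
  note [measurable] = L2_measurable[OF s]
  define d where "d k x = s (Suc k) x - s k x" for k x
  have d_L2: "d k \<in> L2 \<mu>" for k
    unfolding d_def by (intro L2_diff s)
  note [measurable] = L2_measurable[OF d_L2]
  have abs_L2: "(\<lambda>x. \<bar>d k x\<bar>) \<in> L2 \<mu>" for k
    using L2_integrable_square[OF d_L2] by (simp add: L2_def)
  have one_L2: "(\<lambda>_. 1) \<in> L2 \<mu>"
    by (simp add: L2_def)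
  define C where "C = l2_norm \<mu> (\<lambda>_. 1)"
  have abs_int: "integrable \<mu> (\<lambda>x. \<bar>d k x\<bar>)" for k
    using L2_integrable_mult[OF abs_L2 one_L2] by simp
  have abs_le: "(\<integral>x. \<bar>d k x\<bar> \<partial>\<mu>) \<le> C * (1/2) ^ k" for k
  proof -
    have "(\<integral>x. \<bar>d k x\<bar> \<partial>\<mu>) = l2_inner \<mu> (\<lambda>x. \<bar>d k x\<bar>) (\<lambda>_. 1)"
      by (simp add: l2_inner_def)
    also have "\<dots> \<le> l2_norm \<mu> (\<lambda>x. \<bar>d k x\<bar>) * C"
      unfolding C_def using l2_Cauchy_Schwarz[OF abs_L2 one_L2] by (meson abs_le_D1)
    also have "l2_norm \<mu> (\<lambda>x. \<bar>d k x\<bar>) = l2_norm \<mu> (\<lambda>x. s k x - s (Suc k) x)"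
      by (simp add: l2_norm_def d_def power2_commute)
    also have "\<dots> * C \<le> (1/2) ^ k * C"
      using fast[of k "Suc k"] by (intro mult_right_mono) (auto simp: C_def l2_norm_nonneg)
    finally show ?thesis by (simp add: mult.commute)
  qed
  have "(\<integral>\<^sup>+x. (\<Sum>k. ennreal \<bar>d k x\<bar>) \<partial>\<mu>) = (\<Sum>k. \<integral>\<^sup>+x. ennreal \<bar>d k x\<bar> \<partial>\<mu>)"
    by (intro nn_integral_suminf) measurable
  also have "\<dots> = (\<Sum>k. ennreal (\<integral>x. \<bar>d k x\<bar> \<partial>\<mu>))"
    using abs_int by (intro suminf_cong nn_integral_eq_integral) auto
  also have "\<dots> \<le> (\<Sum>k. ennreal (C * (1/2) ^ k))"
    by (intro suminf_le ennreal_leI abs_le) auto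
  also have "\<dots> = ennreal (\<Sum>k. C * (1/2) ^ k)"
    by (intro suminf_ennreal2 summable_mult summable_geometric) (auto simp: C_def l2_norm_nonneg)
  also have "\<dots> < \<infinity>" by simp
  finally have "(\<integral>\<^sup>+x. (\<Sum>k. ennreal \<bar>d k x\<bar>) \<partial>\<mu>) \<noteq> \<infinity>" by simp
  then have "AE x in \<mu>. (\<Sum>k. ennreal \<bar>d k x\<bar>) \<noteq> \<infinity>"
    by (intro nn_integral_PInf_AE) measurable
  \<comment> \<open>\<open>lim\<close> is total and preserves measurability, so \<open>y\<close>
    needs no repair on the null set where the sequence diverges.\<close>
  define y where "y x = lim (\<lambda>n. s n x)" for x
  have y_meas [measurable]: "y \<in> borel_measurable \<mu>"
    unfolding y_def by measurable
  have y_lim: "AE x in \<mu>. (\<lambda>n. s n x) \<longlonglongrightarrow> y x"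
    using \<open>AE x in \<mu>. (\<Sum>k. ennreal \<bar>d k x\<bar>) \<noteq> \<infinity>\<close>
  proof eventually_elim
    case (elim x)
    then have "summable (\<lambda>k. \<bar>d k x\<bar>)"
      by (intro summable_suminf_not_top) auto
    then have "convergent (\<lambda>n. \<Sum>k<n. d k x)"
      using summable_rabs_cancel summable_iff_convergent by blast
    then have "convergent (\<lambda>n. s 0 x + (\<Sum>k<n. d k x))"
      by (simp add: convergent_add_const_iff)
    then have "convergent (\<lambda>n. s n x)"
      by (simp add: d_def sum_lessThan_telescope[of "\<lambda>n. s n x"])
    then show ?case by (simp add: y_def convergent_LIMSEQ_iff)
  qed
  have Fatou: "(\<integral>\<^sup>+x. ennreal ((s n x - y x)\<^sup>2) \<partial>\<mu>) \<le> ennreal (((1/2) ^ n)\<^sup>2)" for n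
  proof -
    have "(\<integral>\<^sup>+x. ennreal ((s n x - y x)\<^sup>2) \<partial>\<mu>) =
        (\<integral>\<^sup>+x. liminf (\<lambda>m. ennreal ((s n x - s m x)\<^sup>2)) \<partial>\<mu>)"
    proof (rule nn_integral_cong_AE, use y_lim in eventually_elim)
      case (elim x)
      have "(\<lambda>m. ennreal ((s n x - s m x)\<^sup>2)) \<longlonglongrightarrow> ennreal ((s n x - y x)\<^sup>2)"
        by (intro tendsto_intros elim)
      then show ?case by (rule lim_imp_Liminf[OF trivial_limit_sequentially, symmetric])
    qed
    also have "\<dots> \<le> liminf (\<lambda>m. \<integral>\<^sup>+x. ennreal ((s n x - s m x)\<^sup>2) \<partial>\<mu>)"
      by (intro nn_integral_liminf) auto
    also have "\<dots> \<le> liminf (\<lambda>m. ennreal (((1/2) ^ n)\<^sup>2))"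
    proof (intro Liminf_mono, use eventually_ge_at_top[of n] in eventually_elim)
      case (elim m)
      have "(\<integral>\<^sup>+x. ennreal ((s n x - s m x)\<^sup>2) \<partial>\<mu>) = ennreal (\<integral>x. (s n x - s m x)\<^sup>2 \<partial>\<mu>)"
        by (intro nn_integral_eq_integral L2_integrable_square[OF L2_diff] s) auto
      also have "\<dots> = ennreal ((l2_norm \<mu> (\<lambda>x. s n x - s m x))\<^sup>2)"
        by (simp add: l2_norm_def)
      also have "\<dots> \<le> ennreal (((1/2) ^ n)\<^sup>2)"
        by (intro ennreal_leI power_mono fast elim l2_norm_nonneg)
      finally show ?case .
    qed
    finally show ?thesis by (simp add: Liminf_const)
  qed
  \<comment> \<open>The Fatou bound is finite, which makes \<open>s n - y\<close> square-integrable
    before \<open>y\<close> is known to be; \<open>y\<close> then follows as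
    \<open>s 0 - (s 0 - y)\<close>.\<close>
  have diff_L2: "(\<lambda>x. s n x - y x) \<in> L2 \<mu>" for n
    unfolding L2_def using order.strict_trans1[OF Fatou ennreal_less_top]
    by (auto intro!: integrableI_bounded)
  have "(\<lambda>x. s 0 x - (s 0 x - y x)) \<in> L2 \<mu>"
    by (intro L2_diff[OF s diff_L2])
  then have "y \<in> L2 \<mu>" by simp
  moreover have le: "l2_norm \<mu> (\<lambda>x. s n x - y x) \<le> (1/2) ^ n" for n
  proof -
    have "ennreal ((l2_norm \<mu> (\<lambda>x. s n x - y x))\<^sup>2) = (\<integral>\<^sup>+x. ennreal ((s n x - y x)\<^sup>2) \<partial>\<mu>)"
      unfolding l2_norm_def
      using nn_integral_eq_integral[OF L2_integrable_square[OF diff_L2[of n]]] by simp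
    also note Fatou
    finally have "(l2_norm \<mu> (\<lambda>x. s n x - y x))\<^sup>2 \<le> ((1/2) ^ n)\<^sup>2"
      by (simp add: ennreal_le_iff)
    then show ?thesis by (rule power2_le_imp_le) simp
  qed
  have "(\<lambda>n. l2_norm \<mu> (\<lambda>x. s n x - y x)) \<longlonglongrightarrow> 0"
  proof (rule Lim_null_comparison)
    show "\<forall>\<^sub>F n in sequentially. norm (l2_norm \<mu> (\<lambda>x. s n x - y x)) \<le> (1/2) ^ n"
      using le by (simp add: l2_norm_nonneg)
    show "(\<lambda>n. (1/2) ^ n :: real) \<longlonglongrightarrow> 0" by (rule LIMSEQ_power_zero) simp
  qed
  ultimately show thesis by (rule that)
qed

lemma l2_parallelogram:
  assumes "f \<in> L2 \<mu>" "g \<in> L2 \<mu>"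
  shows "(l2_norm \<mu> (\<lambda>x. f x - g x))\<^sup>2 =
    2 * (l2_norm \<mu> f)\<^sup>2 + 2 * (l2_norm \<mu> g)\<^sup>2 - 4 * (l2_norm \<mu> (\<lambda>x. (f x + g x) / 2))\<^sup>2"
proof -
  have "l2_norm \<mu> (\<lambda>x. (f x + g x) / 2) = l2_norm \<mu> (\<lambda>x. f x + g x) / 2"
    using l2_norm_cmult[of \<mu> "1/2" "\<lambda>x. f x + g x"] by simp
  then have "4 * (l2_norm \<mu> (\<lambda>x. (f x + g x) / 2))\<^sup>2 = (l2_norm \<mu> (\<lambda>x. f x + g x))\<^sup>2"
    by (simp only: power_divide) simp
  then show ?thesis
    using l2_norm_add_square[OF assms] l2_norm_diff_square[OF assms] by linarith
qed

text \<open>Permits a change of representative: convexity of \<open>S\<close> provides a convex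
  combination only up to norm zero.\<close>

lemma l2_norm_eq_if_diff_zero:
  assumes "f \<in> L2 \<mu>" "g \<in> L2 \<mu>" "l2_norm \<mu> (\<lambda>x. f x - g x) = 0"
  shows "l2_norm \<mu> f = l2_norm \<mu> g"
  using AE_eq_if_l2_norm_zero[OF L2_diff[OF assms(1,2)] assms(3)] assms(1,2)
  by (intro l2_norm_cong_AE) (auto dest: L2_measurable)

text \<open>Shows that the choice operator in \<open>l2_proj\<close> picks a genuine minimiser. A
  minimising sequence is Cauchy by the parallelogram law, because the midpoint of two of its terms
  is represented in \<open>S\<close> and hence is no closer to \<open>h\<close> than the
  infimum.\<close>

lemma l2_proj_minimal:
  assumes "finite_measure \<mu>" and S: "S \<subseteq> L2 \<mu>" "S \<noteq> {}"
    and closed: "l2_closed \<mu> S" and convex: "l2_convex \<mu> S" and h: "h \<in> L2 \<mu>"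
  shows "l2_proj \<mu> S h \<in> S \<and>
    (\<forall>z\<in>S. l2_norm \<mu> (\<lambda>x. l2_proj \<mu> S h x - h x) \<le> l2_norm \<mu> (\<lambda>x. z x - h x))"
proof -
  let ?n = "\<lambda>z. (l2_norm \<mu> (\<lambda>x. z x - h x))\<^sup>2"
  define D where "D = Inf (?n ` S)"
  have bdd: "bdd_below (?n ` S)" by (intro bdd_belowI[of _ 0]) auto
  have D_le: "D \<le> ?n z" if "z \<in> S" for z
    unfolding D_def using that bdd by (intro cInf_lower) auto
  \<comment> \<open>The tolerance is chosen for the parallelogram law: with gaps
    \<open>e / 4\<close> and \<open>e' / 4\<close>, where \<open>e' \<le> e\<close>, the squared
    distance is at most \<open>e / 2 + e' / 2 \<le> e\<close>, exactly the rate that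
    \<open>L2_complete\<close> asks for.\<close>
  have "\<exists>z\<in>S. ?n z < D + ((1/2) ^ k)\<^sup>2 / 4" for k :: nat
    using cInf_lessD[of "?n ` S" "D + ((1/2) ^ k)\<^sup>2 / 4"] S unfolding D_def by auto
  then obtain s where s: "\<And>k. s k \<in> S" and s_D: "\<And>k. ?n (s k) < D + ((1/2) ^ k)\<^sup>2 / 4"
    by metis
  have s_L2: "s k \<in> L2 \<mu>" for k using s S by auto
  have fast: "l2_norm \<mu> (\<lambda>x. s n x - s m x) \<le> (1/2) ^ n" if "n \<le> m" for n m
  proof (rule power2_le_imp_le)
    obtain z where z: "z \<in> S" "l2_norm \<mu> (\<lambda>x. (1 - 1/2) * s n x + 1/2 * s m x - z x) = 0"
      using convex[unfolded l2_convex_def, rule_format, OF s s, of "1/2" n m] by auto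
    have z_L2: "z \<in> L2 \<mu>" using z S by auto
    have mid: "(\<lambda>x. ((s n x - h x) + (s m x - h x)) / 2) \<in> L2 \<mu>"
      using L2_cmult[OF L2_add[OF L2_diff[OF s_L2[of n] h] L2_diff[OF s_L2[of m] h]], of "1/2"] by simp
    have "(\<lambda>x. (1 - 1/2) * s n x + 1/2 * s m x - z x) =
        (\<lambda>x. ((s n x - h x) + (s m x - h x)) / 2 - (z x - h x))"
      by (auto simp: fun_eq_iff field_simps)
    then have "l2_norm \<mu> (\<lambda>x. ((s n x - h x) + (s m x - h x)) / 2) = l2_norm \<mu> (\<lambda>x. z x - h x)"
      using z(2) by (intro l2_norm_eq_if_diff_zero mid L2_diff z_L2 h) simp
    then have "(l2_norm \<mu> (\<lambda>x. (s n x - h x) - (s m x - h x)))\<^sup>2 = 2 * ?n (s n) + 2 * ?n (s m) - 4 * ?n z"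
      by (simp only: l2_parallelogram[OF L2_diff[OF s_L2 h] L2_diff[OF s_L2 h]])
    also have "\<dots> \<le> ((1/2) ^ n)\<^sup>2"
    proof -
      have "2 * a + 2 * b - 4 * c \<le> e"
        if "a < D + e / 4" "b < D + e' / 4" "D \<le> c" "e' \<le> e" for a b c e e' :: real
        using that by linarith
      moreover have "((1/2) ^ m :: real)\<^sup>2 \<le> ((1/2) ^ n)\<^sup>2"
        using that by (intro power_mono power_decreasing) auto
      ultimately show ?thesis using s_D D_le[OF z(1)] by blast
    qed
    finally show "(l2_norm \<mu> (\<lambda>x. s n x - s m x))\<^sup>2 \<le> ((1/2) ^ n)\<^sup>2" by simp
  qed simp
  obtain y where y: "y \<in> L2 \<mu>" "(\<lambda>n. l2_norm \<mu> (\<lambda>x. s n x - y x)) \<longlonglongrightarrow> 0"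
    using L2_complete[OF assms(1) s_L2 fast] by blast
  then obtain z where z: "z \<in> S" "l2_norm \<mu> (\<lambda>x. y x - z x) = 0"
    using closed s unfolding l2_closed_def by blast
  have z_L2: "z \<in> L2 \<mu>" using z S by auto
  have "l2_norm \<mu> (\<lambda>x. z x - h x) \<le> sqrt D"
  proof (rule LIMSEQ_le_const)
    have "(\<lambda>n. l2_norm \<mu> (\<lambda>x. s n x - y x) + sqrt (D + ((1/2) ^ n)\<^sup>2 / 4)) \<longlonglongrightarrow> 0 + sqrt (D + 0\<^sup>2 / 4)"
      by (intro tendsto_intros y(2) LIMSEQ_power_zero) auto
    then show "(\<lambda>n. l2_norm \<mu> (\<lambda>x. s n x - y x) + sqrt (D + ((1/2) ^ n)\<^sup>2 / 4)) \<longlonglongrightarrow> sqrt D"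
      by simp
    have "l2_norm \<mu> (\<lambda>x. z x - h x) \<le> l2_norm \<mu> (\<lambda>x. s n x - y x) + sqrt (D + ((1/2) ^ n)\<^sup>2 / 4)" for n
    proof -
      have "l2_norm \<mu> (\<lambda>x. s n x - h x) \<le> sqrt (D + ((1/2) ^ n)\<^sup>2 / 4)"
        using s_D[of n] by (simp add: real_le_rsqrt)
      then show ?thesis
        using l2_norm_triangle_diff[OF z_L2 y(1) h] l2_norm_triangle_diff[OF y(1) s_L2[of n] h] z(2)
          l2_norm_minus_commute[of \<mu> z y] l2_norm_minus_commute[of \<mu> y "s n"]
        by linarith
    qed
    then show "\<exists>N. \<forall>n\<ge>N. l2_norm \<mu> (\<lambda>x. z x - h x) \<le>
        l2_norm \<mu> (\<lambda>x. s n x - y x) + sqrt (D + ((1/2) ^ n)\<^sup>2 / 4)" by blast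
  qed
  moreover have "sqrt D \<le> l2_norm \<mu> (\<lambda>x. w x - h x)" if "w \<in> S" for w
    using D_le[OF that] by (simp add: real_le_lsqrt l2_norm_nonneg)
  ultimately have "z \<in> S \<and> (\<forall>w\<in>S. l2_norm \<mu> (\<lambda>x. z x - h x) \<le> l2_norm \<mu> (\<lambda>x. w x - h x))"
    using z(1) by (blast intro: order_trans)
  then show ?thesis
    unfolding l2_proj_def
    by (rule someI[where P = "\<lambda>y. y \<in> S \<and> (\<forall>z\<in>S. l2_norm \<mu> (\<lambda>x. y x - h x) \<le> l2_norm \<mu> (\<lambda>x. z x - h x))"])
qed

text \<open>Obtuse-angle criterion: moving from the projection \<open>q\<close> towards
  \<open>y\<close> cannot reduce the distance to \<open>h\<close>, so the inner product of
  \<open>q - h\<close> and \<open>y - q\<close> is nonnegative, and expanding the square of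
  \<open>(q - h) + (y - q)\<close> leaves at least the square of \<open>y - q\<close>.\<close>

lemma l2_proj_dist_le:
  assumes "finite_measure \<mu>" and S: "S \<subseteq> L2 \<mu>"
    and "l2_closed \<mu> S" and convex: "l2_convex \<mu> S" and h: "h \<in> L2 \<mu>" and y: "y \<in> S"
  shows "l2_norm \<mu> (\<lambda>x. y x - l2_proj \<mu> S h x) \<le> l2_norm \<mu> (\<lambda>x. y x - h x)"
proof -
  define q where "q = l2_proj \<mu> S h"
  have q: "q \<in> S" and q_min: "\<And>z. z \<in> S \<Longrightarrow> l2_norm \<mu> (\<lambda>x. q x - h x) \<le> l2_norm \<mu> (\<lambda>x. z x - h x)"
    unfolding q_def using l2_proj_minimal[OF assms(1) S _ assms(3,4) h] y by auto
  have L2: "y \<in> L2 \<mu>" "q \<in> L2 \<mu>" using S y q by auto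
  let ?i = "l2_inner \<mu> (\<lambda>x. q x - h x) (\<lambda>x. y x - q x)" and ?b = "(l2_norm \<mu> (\<lambda>x. y x - q x))\<^sup>2"
  note dL2 = L2_diff[OF L2(2) h] L2_diff[OF L2]
  have var: "0 \<le> 2 * ?i + u * ?b" if u: "0 < u" "u \<le> 1" for u
  proof -
    obtain z where z: "z \<in> S" "l2_norm \<mu> (\<lambda>x. (1 - u) * q x + u * y x - z x) = 0"
      using convex[unfolded l2_convex_def, rule_format, OF q y, of u] u by auto
    have z_L2: "z \<in> L2 \<mu>" using z S by auto
    have "(\<lambda>x. (1 - u) * q x + u * y x - z x) = (\<lambda>x. ((q x - h x) + u * (y x - q x)) - (z x - h x))"
      by (auto simp: fun_eq_iff algebra_simps)
    then have "l2_norm \<mu> (\<lambda>x. (q x - h x) + u * (y x - q x)) = l2_norm \<mu> (\<lambda>x. z x - h x)"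
      using z(2) by (intro l2_norm_eq_if_diff_zero L2_add L2_cmult L2_diff z_L2 h L2) simp
    then have "(l2_norm \<mu> (\<lambda>x. q x - h x))\<^sup>2 \<le> (l2_norm \<mu> (\<lambda>x. (q x - h x) + u * (y x - q x)))\<^sup>2"
      using q_min[OF z(1)] by (intro power_mono l2_norm_nonneg) simp
    also have "\<dots> = (l2_norm \<mu> (\<lambda>x. q x - h x))\<^sup>2 + u * (2 * ?i + u * ?b)"
      unfolding l2_norm_add_square[OF dL2(1) L2_cmult[OF dL2(2)]] l2_norm_cmult
        l2_inner_commute[of _ "\<lambda>x. q x - h x"] l2_inner_cmult_left
      by (simp add: power2_eq_square algebra_simps)
    finally have "0 \<le> u * (2 * ?i + u * ?b)" by simp
    then show ?thesis using u by (simp add: zero_le_mult_iff)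
  qed
  \<comment> \<open>The minimality inequality has already been divided by \<open>u\<close>; letting
    \<open>u\<close> tend to 0 from the right removes the quadratic remainder.\<close>
  have "0 \<le> 2 * ?i"
  proof (rule tendsto_lowerbound)
    show "((\<lambda>u. 2 * ?i + u * ?b) \<longlongrightarrow> 2 * ?i) (at_right 0)"
      by (auto intro!: tendsto_eq_intros)
    show "\<forall>\<^sub>F u in at_right 0. 0 \<le> 2 * ?i + u * ?b"
      using var by (auto simp: eventually_at_right_field intro!: exI[of _ 1])
  qed simp
  then have "?b \<le> (l2_norm \<mu> (\<lambda>x. (q x - h x) + (y x - q x)))\<^sup>2"
    unfolding l2_norm_add_square[OF dL2] by simp
  then have "?b \<le> (l2_norm \<mu> (\<lambda>x. y x - h x))\<^sup>2" by (simp add: algebra_simps)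
  then show ?thesis
    unfolding q_def[symmetric] by (rule power2_le_imp_le) (rule l2_norm_nonneg)
qed

section \<open>Finite orthonormal systems exhausting the norm\<close>

definition l2_orthonormal :: "'x measure \<Rightarrow> 'j set \<Rightarrow> ('j \<Rightarrow> 'x \<Rightarrow> real) \<Rightarrow> bool" where
  "l2_orthonormal \<mu> J e \<longleftrightarrow> finite J \<and> (\<forall>j\<in>J. e j \<in> L2 \<mu>) \<and>
     (\<forall>i\<in>J. \<forall>j\<in>J. l2_inner \<mu> (e i) (e j) = (if i = j then 1 else 0))"

text \<open>Pythagoras with arbitrary coefficients: the error is the distance to the span plus the
  deviation from the Fourier coefficients. Fourier coefficients give Bessel's inequality; a good but
  otherwise arbitrary \<open>c\<close> shows that the Bessel sum nearly attains the norm.\<close>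

lemma l2_orthonormal_approximation:
  assumes e: "l2_orthonormal \<mu> J e" and f: "f \<in> L2 \<mu>"
  shows "(l2_norm \<mu> (\<lambda>x. f x - (\<Sum>j\<in>J. c j * e j x)))\<^sup>2 =
    (l2_norm \<mu> f)\<^sup>2 - (\<Sum>j\<in>J. (l2_inner \<mu> f (e j))\<^sup>2) + (\<Sum>j\<in>J. (c j - l2_inner \<mu> f (e j))\<^sup>2)"
proof -
  have J: "finite J" and eL2: "\<And>j. j \<in> J \<Longrightarrow> e j \<in> L2 \<mu>"
    and on: "\<And>i j. i \<in> J \<Longrightarrow> j \<in> J \<Longrightarrow> l2_inner \<mu> (e i) (e j) = (if i = j then 1 else 0)"
    using e by (auto simp: l2_orthonormal_def)
  let ?g = "\<lambda>x. \<Sum>j\<in>J. c j * e j x"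
  have g: "?g \<in> L2 \<mu>" by (intro L2_sum L2_cmult eL2)
  have inner_g: "l2_inner \<mu> ?g h = (\<Sum>j\<in>J. c j * l2_inner \<mu> (e j) h)" if "h \<in> L2 \<mu>" for h
    using that eL2 by (subst l2_inner_sum_left) (auto simp: L2_cmult l2_inner_cmult_left)
  have "(l2_norm \<mu> ?g)\<^sup>2 = (\<Sum>i\<in>J. c i * l2_inner \<mu> ?g (e i))"
    unfolding l2_norm_square inner_g[OF g] by (simp add: l2_inner_commute)
  also have "\<dots> = (\<Sum>i\<in>J. c i * (\<Sum>j\<in>J. c j * (if j = i then 1 else 0)))"
    by (intro sum.cong refl) (simp add: inner_g eL2 on)
  also have "\<dots> = (\<Sum>i\<in>J. (c i)\<^sup>2)"
    using J by (simp add: power2_eq_square if_distrib[of "\<lambda>t. _ * t"] cong: if_cong)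
  finally have norm_g: "(l2_norm \<mu> ?g)\<^sup>2 = (\<Sum>i\<in>J. (c i)\<^sup>2)" .
  have "l2_inner \<mu> f ?g = (\<Sum>j\<in>J. c j * l2_inner \<mu> f (e j))"
    using inner_g[OF f] by (simp add: l2_inner_commute[of _ f])
  then show ?thesis
    unfolding l2_norm_diff_square[OF f g] norm_g
    by (simp add: power2_diff sum.distrib sum_subtractf sum_distrib_left algebra_simps)
qed

lemma l2_Bessel:
  assumes "l2_orthonormal \<mu> J e" "f \<in> L2 \<mu>"
  shows "(\<Sum>j\<in>J. (l2_inner \<mu> f (e j))\<^sup>2) \<le> (l2_norm \<mu> f)\<^sup>2"
  using l2_orthonormal_approximation[OF assms, of "\<lambda>j. l2_inner \<mu> f (e j)"]
    zero_le_power2[of "l2_norm \<mu> (\<lambda>x. f x - (\<Sum>j\<in>J. l2_inner \<mu> f (e j) * e j x))"] by simp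

text \<open>Any approximation in the span, not only the orthogonal projection, bounds the defect in
  Bessel's inequality. No relation between the systems for different \<open>n\<close>
  enters.\<close>

lemma l2_Parseval_limit:
  assumes e: "\<And>n. l2_orthonormal \<mu> (J n) (e n)" and f: "f \<in> L2 \<mu>"
    and dense: "\<And>r. 0 < r \<Longrightarrow> \<forall>\<^sub>F n in sequentially. \<exists>c. l2_norm \<mu> (\<lambda>x. f x - (\<Sum>j\<in>J n. c j * e n j x)) \<le> r"
  shows "(\<lambda>n. \<Sum>j\<in>J n. (l2_inner \<mu> f (e n j))\<^sup>2) \<longlonglongrightarrow> (l2_norm \<mu> f)\<^sup>2"
proof (rule LIMSEQ_I)
  fix r :: real
  assume r: "0 < r"
  have "\<forall>\<^sub>F n in sequentially. norm ((\<Sum>j\<in>J n. (l2_inner \<mu> f (e n j))\<^sup>2) - (l2_norm \<mu> f)\<^sup>2) < r"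
    using dense[OF real_sqrt_gt_zero[OF half_gt_zero[OF r]]]
  proof eventually_elim
    case (elim n)
    then obtain c where c: "l2_norm \<mu> (\<lambda>x. f x - (\<Sum>j\<in>J n. c j * e n j x)) \<le> sqrt (r / 2)"
      by auto
    have "(l2_norm \<mu> (\<lambda>x. f x - (\<Sum>j\<in>J n. c j * e n j x)))\<^sup>2 \<le> (sqrt (r / 2))\<^sup>2"
      by (intro power_mono c l2_norm_nonneg)
    then have "(l2_norm \<mu> f)\<^sup>2 - (\<Sum>j\<in>J n. (l2_inner \<mu> f (e n j))\<^sup>2) \<le> r / 2"
      unfolding l2_orthonormal_approximation[OF e f]
      using r sum_nonneg[of "J n" "\<lambda>j. (c j - l2_inner \<mu> f (e n j))\<^sup>2"] by simp
    then show ?case using l2_Bessel[OF e f, of n] r by simp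
  qed
  then show "\<exists>no. \<forall>n\<ge>no. norm ((\<Sum>j\<in>J n. (l2_inner \<mu> f (e n j))\<^sup>2) - (l2_norm \<mu> f)\<^sup>2) < r"
    by (simp add: eventually_sequentially)
qed

section \<open>Complete systems: step functions on an interval, unit vectors on a finite set\<close>

lemma l2_norm_le_bound:
  assumes "finite_measure \<mu>" "f \<in> borel_measurable \<mu>" "AE x in \<mu>. \<bar>f x\<bar> \<le> B" and B: "0 \<le> B"
  shows "l2_norm \<mu> f \<le> B * sqrt (measure \<mu> (space \<mu>))"
proof -
  interpret finite_measure \<mu> by fact
  have "(\<integral>x. (f x)\<^sup>2 \<partial>\<mu>) \<le> (\<integral>x. B\<^sup>2 \<partial>\<mu>)"
  proof (rule integral_mono_AE)
    show "integrable \<mu> (\<lambda>x. (f x)\<^sup>2)" by (rule L2_integrable_square[OF L2_bounded[OF assms(1-3)]])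
    show "AE x in \<mu>. (f x)\<^sup>2 \<le> B\<^sup>2"
      using assms(3) by eventually_elim (metis abs_ge_zero power2_abs power_mono)
  qed simp
  then have "l2_norm \<mu> f \<le> sqrt (B\<^sup>2 * measure \<mu> (space \<mu>))"
    unfolding l2_norm_def by (simp add: mult.commute)
  then show ?thesis using B by (simp add: real_sqrt_mult)
qed

lemma l2_norm_tendsto_zero:
  fixes g :: "nat \<Rightarrow> 'x \<Rightarrow> real"
  assumes "\<And>n. g n \<in> borel_measurable \<mu>" "integrable \<mu> w"
    and "AE x in \<mu>. (\<lambda>n. g n x) \<longlonglongrightarrow> 0" "\<And>n. AE x in \<mu>. (g n x)\<^sup>2 \<le> w x"
  shows "(\<lambda>n. l2_norm \<mu> (g n)) \<longlonglongrightarrow> 0"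
proof -
  have "(\<lambda>n. \<integral>x. (g n x)\<^sup>2 \<partial>\<mu>) \<longlonglongrightarrow> (\<integral>x. 0 \<partial>\<mu>)"
  proof (rule integral_dominated_convergence)
    show "AE x in \<mu>. (\<lambda>n. (g n x)\<^sup>2) \<longlonglongrightarrow> 0"
      using assms(3) by eventually_elim (auto intro!: tendsto_eq_intros)
    show "AE x in \<mu>. norm ((g n x)\<^sup>2) \<le> w x" for n
      using assms(4)[of n] by simp
  qed (use assms(1,2) in auto)
  then show ?thesis
    unfolding l2_norm_def using tendsto_real_sqrt by fastforce
qed

lemma finite_measure_lebesgue_on_interval: "finite_measure (lebesgue_on {a..b::real})"
  by (intro finite_measure_lebesgue_on) (simp add: lmeasurable_cbox[of a b, simplified])

text \<open>Two dominated convergences. Truncating \<open>f\<close> at a large level costs little;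
  the truncation is then approximated by truncated continuous functions, which remain continuous and
  share one bound.\<close>

lemma L2_continuous_dense:
  fixes f :: "real \<Rightarrow> real"
  assumes f: "f \<in> L2 (lebesgue_on {a..b})" and r: "0 < r"
  obtains g where "continuous_on UNIV g" "g \<in> L2 (lebesgue_on {a..b})"
    "l2_norm (lebesgue_on {a..b}) (\<lambda>x. f x - g x) < r"
proof -
  let ?\<mu> = "lebesgue_on {a..b}"
  interpret finite_measure ?\<mu> by (rule finite_measure_lebesgue_on_interval)
  have f_meas [measurable]: "f \<in> borel_measurable ?\<mu>" by (rule L2_measurable[OF f])
  define clip where "clip k y = max (- real k) (min (real k) y)" for k and y :: real
  have clip_cont: "continuous_on A (clip k)" for k A
    unfolding clip_def by (intro continuous_intros)
  have clip_meas [measurable]: "clip k \<in> borel_measurable borel" for k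
    using clip_cont by (rule borel_measurable_continuous_onI)
  have clip_le: "\<bar>clip k y\<bar> \<le> real k" for k y unfolding clip_def by auto
  have clip_L2: "(\<lambda>x. clip k (h x)) \<in> L2 ?\<mu>" if [measurable]: "h \<in> borel_measurable ?\<mu>" for k h
    by (rule L2_bounded[OF finite_measure_axioms, of _ "real k"]) (auto simp: clip_le)
  have "(\<lambda>k. l2_norm ?\<mu> (\<lambda>x. f x - clip k (f x))) \<longlonglongrightarrow> 0"
  proof (rule l2_norm_tendsto_zero[OF _ L2_integrable_square[OF f]])
    have "\<forall>\<^sub>F k in sequentially. f x - clip k (f x) = 0" for x
    proof -
      obtain k0 :: nat where "\<bar>f x\<bar> \<le> real k0" using real_arch_simple by blast
      then show ?thesis
        unfolding eventually_sequentially by (intro exI[of _ k0]) (auto simp: clip_def)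
    qed
    then show "AE x in ?\<mu>. (\<lambda>k. f x - clip k (f x)) \<longlonglongrightarrow> 0"
      by (intro AE_I2 tendsto_eventually)
    show "AE x in ?\<mu>. (f x - clip k (f x))\<^sup>2 \<le> (f x)\<^sup>2" for k
      by (rule AE_I2) (auto simp: clip_def abs_le_square_iff[symmetric])
  qed measurable
  then have "\<forall>\<^sub>F k in sequentially. l2_norm ?\<mu> (\<lambda>x. f x - clip k (f x)) < r / 2"
    using r by (intro order_tendstoD) auto
  then obtain k where k: "l2_norm ?\<mu> (\<lambda>x. f x - clip k (f x)) < r / 2"
    by (auto simp: eventually_sequentially)
  \<comment> \<open>Unfolding this notion gives continuous functions converging to \<open>f\<close>
    pointwise off a negligible set, but with no common bound. Applying \<open>clip k\<close> to them
    supplies the dominating constant \<open>2 * k\<close>.\<close>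
  have "f measurable_on {a..b}"
    by (subst measurable_on_iff_borel_measurable) auto
  then obtain N g where N: "negligible N" and g: "\<And>n. continuous_on UNIV (g n)"
    and lim: "\<And>x. x \<notin> N \<Longrightarrow> (\<lambda>n. g n x) \<longlonglongrightarrow> (if x \<in> {a..b} then f x else 0)"
    unfolding measurable_on_def by blast
  have g_meas [measurable]: "g n \<in> borel_measurable ?\<mu>" for n
    using g[of n] by (intro continuous_imp_measurable_on_sets_lebesgue) (auto intro: continuous_on_subset)
  have "AE x in lebesgue. x \<notin> N"
    using N by (intro AE_not_in) (simp add: negligible_iff_null_sets)
  then have N_AE: "AE x in ?\<mu>. x \<notin> N"
    by (subst AE_restrict_space_iff) auto
  have "(\<lambda>n. l2_norm ?\<mu> (\<lambda>x. clip k (f x) - clip k (g n x))) \<longlonglongrightarrow> 0"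
  proof (rule l2_norm_tendsto_zero[where w = "\<lambda>_. (2 * real k)\<^sup>2"])
    show "AE x in ?\<mu>. (\<lambda>n. clip k (f x) - clip k (g n x)) \<longlonglongrightarrow> 0"
      using N_AE AE_space
    proof eventually_elim
      case (elim x)
      then have "(\<lambda>n. g n x) \<longlonglongrightarrow> f x" using lim[of x] by simp
      then have "(\<lambda>n. clip k (g n x)) \<longlonglongrightarrow> clip k (f x)"
        using continuous_on_tendsto_compose[OF clip_cont[of UNIV k]] by simp
      from tendsto_diff[OF tendsto_const[of "clip k (f x)"] this] show ?case by simp
    qed
    have "\<bar>clip k y - clip k z\<bar> \<le> \<bar>2 * real k\<bar>" for y z
      using clip_le[of k y] clip_le[of k z] by linarith
    then show "AE x in ?\<mu>. (clip k (f x) - clip k (g n x))\<^sup>2 \<le> (2 * real k)\<^sup>2" for n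
      by (simp only: abs_le_square_iff) simp
  qed auto
  then have "\<forall>\<^sub>F n in sequentially. l2_norm ?\<mu> (\<lambda>x. clip k (f x) - clip k (g n x)) < r / 2"
    using r by (intro order_tendstoD) auto
  then obtain n where n: "l2_norm ?\<mu> (\<lambda>x. clip k (f x) - clip k (g n x)) < r / 2"
    by (auto simp: eventually_sequentially)
  show thesis
  proof (rule that)
    show "continuous_on UNIV (\<lambda>x. clip k (g n x))"
      by (rule continuous_on_compose2[OF clip_cont[of UNIV] g]) auto
    show "(\<lambda>x. clip k (g n x)) \<in> L2 ?\<mu>" by (rule clip_L2) measurable
    show "l2_norm ?\<mu> (\<lambda>x. f x - clip k (g n x)) < r"
      using l2_norm_triangle_diff[OF f clip_L2[OF f_meas, of k] clip_L2[OF g_meas, of k n]] k n by linarith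
  qed
qed


text \<open>The \<open>n\<close>-th system consists of the \<open>Suc n\<close> indicators of equal
  half-open cells, divided by \<open>sqrt (h n)\<close> to have norm one. Uniform continuity makes a
  continuous function nearly constant on small cells, and continuous functions are dense.\<close>

lemma lebesgue_on_orthonormal_exhaustion:
  fixes a b :: real
  assumes ab: "a < b"
  obtains J :: "nat \<Rightarrow> nat set" and e where "\<And>n. l2_orthonormal (lebesgue_on {a..b}) (J n) (e n)"
    "\<And>f. f \<in> L2 (lebesgue_on {a..b}) \<Longrightarrow>
      (\<lambda>n. \<Sum>j\<in>J n. (l2_inner (lebesgue_on {a..b}) f (e n j))\<^sup>2) \<longlonglongrightarrow> (l2_norm (lebesgue_on {a..b}) f)\<^sup>2"
proof -
  let ?\<mu> = "lebesgue_on {a..b}"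
  define h where "h n = (b - a) / real (Suc n)" for n
  define I where "I n j = {a + real j * h n ..< a + real (Suc j) * h n}" for n j
  define e where "e n j x = indicator (I n j) x / sqrt (h n)" for n j and x :: real
  have h: "0 < h n" for n using ab by (simp add: h_def)
  have I_unique: "i = j" if "x \<in> I n i" "x \<in> I n j" for x n i j
  proof -
    have less: "x < y" if "i < j" "x \<in> I n i" "y \<in> I n j" for x y i j
    proof -
      have "real (Suc i) * h n \<le> real j * h n"
        using that(1) h[of n] by (intro mult_right_mono) auto
      then show ?thesis using that by (auto simp: I_def)
    qed
    show ?thesis using less[of i j x x] less[of j i x x] that by (cases i j rule: linorder_cases) auto
  qed
  have I_subset: "I n j \<subseteq> {a..b}" if "j \<le> n" for n j
  proof -
    have "0 \<le> real j * h n" using h[of n] by simp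
    moreover have "real (Suc j) * h n \<le> real (Suc n) * h n"
      using h[of n] that by (intro mult_right_mono) auto
    moreover have "real (Suc n) * h n = b - a" by (simp add: h_def)
    ultimately show ?thesis by (auto simp: I_def)
  qed
  have ind_meas [measurable]: "indicator (I n j) \<in> borel_measurable ?\<mu>" for n j
    by (intro measurable_restrict_space1 borel_measurable_indicator) (auto simp: I_def)
  have e_meas [measurable]: "e n j \<in> borel_measurable ?\<mu>" for n j
    unfolding e_def by measurable
  have e_L2: "e n j \<in> L2 ?\<mu>" for n j
    using h[of n] by (intro L2_bounded[OF finite_measure_lebesgue_on_interval, of _ _ _ "1 / sqrt (h n)"])
      (auto simp: e_def indicator_def)
  have e_inner: "l2_inner ?\<mu> (e n i) (e n j) = (if i = j then 1 else 0)" if "i \<le> n" "j \<le> n" for n i j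
  proof (cases "i = j")
    case True
    have "l2_inner ?\<mu> (e n i) (e n i) = (\<integral>x. indicator (I n i) x / h n \<partial>?\<mu>)"
      unfolding l2_inner_def using h[of n]
      by (intro Bochner_Integration.integral_cong) (auto simp: e_def indicator_def)
    also have "\<dots> = measure ?\<mu> (I n i) / h n"
      using I_subset[OF that(1)] by (simp add: Int_absorb2)
    also have "measure ?\<mu> (I n i) = measure lebesgue (I n i)"
      using I_subset[OF that(1)] by (intro measure_restrict_space) auto
    also have "\<dots> = h n"
      using h[of n] by (simp add: I_def algebra_simps)
    finally show ?thesis using True h[of n] by simp
  next
    case False
    then have "(\<lambda>x. e n i x * e n j x) = (\<lambda>_. 0)"
      using I_unique[of _ n i j] by (intro ext) (auto simp: e_def indicator_def)
    then show ?thesis using False by (simp add: l2_inner_def)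
  qed
  have on: "l2_orthonormal ?\<mu> {..n} (e n)" for n
    unfolding l2_orthonormal_def using e_L2 e_inner by auto
  have "(\<lambda>n. \<Sum>j\<in>{..n}. (l2_inner ?\<mu> f (e n j))\<^sup>2) \<longlonglongrightarrow> (l2_norm ?\<mu> f)\<^sup>2" if f: "f \<in> L2 ?\<mu>" for f
  proof (rule l2_Parseval_limit[OF on f])
    fix r :: real
    assume r: "0 < r"
    obtain g where g: "continuous_on UNIV g" "g \<in> L2 ?\<mu>" "l2_norm ?\<mu> (\<lambda>x. f x - g x) < r / 2"
      using L2_continuous_dense[OF f half_gt_zero[OF r]] by blast
    \<comment> \<open>A uniform error \<open>w\<close> on an interval of length \<open>b - a\<close>
      has norm at most \<open>w * sqrt (b - a) = r / 2\<close>; the other half of \<open>r\<close>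
      is spent on replacing \<open>f\<close> by \<open>g\<close>.\<close>
    define w where "w = r / (2 * sqrt (b - a))"
    have w: "0 < w" using r ab by (simp add: w_def)
    have "uniformly_continuous_on {a..b} g"
      using g(1) by (intro compact_uniformly_continuous) (auto intro: continuous_on_subset)
    then obtain d where d: "0 < d"
      "\<And>x y. x \<in> {a..b} \<Longrightarrow> y \<in> {a..b} \<Longrightarrow> \<bar>y - x\<bar> < d \<Longrightarrow> \<bar>g y - g x\<bar> < w"
      using w unfolding uniformly_continuous_on_def dist_real_def by metis
    have "h \<longlonglongrightarrow> 0"
      unfolding h_def using LIMSEQ_Suc[OF lim_const_over_n[of "b - a"]] by simp
    then have "\<forall>\<^sub>F n in sequentially. h n < d"
      using d(1) by (rule order_tendstoD)
    then show "\<forall>\<^sub>F n in sequentially. \<exists>c. l2_norm ?\<mu> (\<lambda>x. f x - (\<Sum>j\<in>{..n}. c j * e n j x)) \<le> r"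
    proof eventually_elim
      case (elim n)
      \<comment> \<open>The value of \<open>g\<close> at the left end of the cell; the factor
        \<open>sqrt (h n)\<close> undoes the normalisation of \<open>e n j\<close>.\<close>
      define c where "c j = g (a + real j * h n) * sqrt (h n)" for j
      let ?s = "\<lambda>x. \<Sum>j\<in>{..n}. c j * e n j x"
      have s_L2: "?s \<in> L2 ?\<mu>" by (intro L2_sum L2_cmult e_L2)
      have close: "\<bar>g x - ?s x\<bar> \<le> w" if x: "a \<le> x" "x < b" for x
      proof -
        define j where "j = nat \<lfloor>(x - a) / h n\<rfloor>"
        have j: "real j \<le> (x - a) / h n" "(x - a) / h n < real (Suc j)"
          using x h[of n] floor_correct[of "(x - a) / h n"] by (auto simp: j_def add.commute)
        then have xI: "x \<in> I n j" using h[of n] by (auto simp: I_def field_simps)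
        have "(x - a) / h n < (b - a) / h n"
          using x h[of n] by (intro divide_strict_right_mono) auto
        also have "\<dots> = real (Suc n)" using ab by (simp add: h_def)
        finally have "(x - a) / h n < real (Suc n)" .
        with j(1) have jn: "j \<le> n" by linarith
        have "c i * e n i x = (if i = j then g (a + real j * h n) else 0)" for i
        proof (cases "i = j")
          case True
          then show ?thesis using xI h[of n] by (simp add: c_def e_def)
        next
          case False
          then have "x \<notin> I n i" using I_unique xI by blast
          then show ?thesis using False by (simp add: e_def)
        qed
        then have "?s x = g (a + real j * h n)" using jn by simp
        moreover have "\<bar>g x - g (a + real j * h n)\<bar> < w"
        proof (rule d(2))
          show "a + real j * h n \<in> {a..b}" using x xI h[of n] by (auto simp: I_def)
          show "\<bar>x - (a + real j * h n)\<bar> < d" using xI elim by (auto simp: I_def algebra_simps)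
        qed (use x in auto)
        ultimately show ?thesis by simp
      qed
      \<comment> \<open>The cells are half-open, so the endpoint \<open>b\<close> lies in none of
        the cells \<open>0..n\<close> and is discarded as a null set.\<close>
      have "AE x in lebesgue. x \<notin> {b}"
        by (intro AE_not_in) (simp add: negligible_iff_null_sets[symmetric])
      then have "AE x in ?\<mu>. x \<noteq> b"
        by (subst AE_restrict_space_iff) auto
      then have "AE x in ?\<mu>. \<bar>g x - ?s x\<bar> \<le> w"
        using AE_space by eventually_elim (auto intro: close)
      then have "l2_norm ?\<mu> (\<lambda>x. g x - ?s x) \<le> w * sqrt (measure ?\<mu> (space ?\<mu>))"
        using w L2_measurable[OF L2_diff[OF g(2) s_L2]]
        by (intro l2_norm_le_bound[OF finite_measure_lebesgue_on_interval]) auto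
      also have "\<dots> = r / 2"
        using ab by (simp add: w_def measure_restrict_space)
      finally have "l2_norm ?\<mu> (\<lambda>x. f x - ?s x) \<le> r"
        using l2_norm_triangle_diff[OF f g(2) s_L2] g(3) by linarith
      then show ?case by blast
    qed
  qed
  with on show thesis by (rule that)
qed

lemma count_space_orthonormal_exhaustion:
  fixes A :: "'x set"
  assumes A: "finite A"
  shows "l2_orthonormal (count_space A) A (\<lambda>j x. if x = j then 1 else 0)"
    and "(\<Sum>j\<in>A. (l2_inner (count_space A) f (\<lambda>x. if x = j then 1 else 0))\<^sup>2) = (l2_norm (count_space A) f)\<^sup>2"
proof -
  have inner: "l2_inner (count_space A) g (\<lambda>x. if x = j then 1 else 0) = g j" if "j \<in> A" for g j
    using A that by (simp add: l2_inner_def lebesgue_integral_count_space_finite if_distrib[of "\<lambda>t. _ * t"] cong: if_cong)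
  then show "l2_orthonormal (count_space A) A (\<lambda>j x. if x = j then 1 else 0)"
    using A by (auto simp: l2_orthonormal_def L2_def integrable_count_space)
  show "(\<Sum>j\<in>A. (l2_inner (count_space A) f (\<lambda>x. if x = j then 1 else 0))\<^sup>2) = (l2_norm (count_space A) f)\<^sup>2"
    using A inner unfolding l2_norm_square l2_inner_def[of _ f f]
    by (simp add: lebesgue_integral_count_space_finite power2_eq_square)
qed

section \<open>Hoeffding's inequality for Euclidean norms\<close>

text \<open>Expresses that \<open>cosh (sqrt s)\<close> is increasing and convex in
  \<open>s \<ge> 0\<close>. It is proved termwise in the power series: only even powers occur, and
  the term of degree \<open>2 * k\<close> is a positive multiple of \<open>s ^ k\<close>.\<close>

lemma cosh_le_convex_combination:
  fixes q a b v :: real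
  assumes v: "0 \<le> v" "v \<le> 1" and q: "q\<^sup>2 \<le> (1 - v) * a\<^sup>2 + v * b\<^sup>2"
  shows "cosh q \<le> (1 - v) * cosh a + v * cosh b"
proof (rule sums_le)
  show "(\<lambda>n. if even n then q ^ n /\<^sub>R fact n else 0) sums cosh q"
    by (rule cosh_converges)
  show "(\<lambda>n. (1 - v) * (if even n then a ^ n /\<^sub>R fact n else 0)
      + v * (if even n then b ^ n /\<^sub>R fact n else 0)) sums ((1 - v) * cosh a + v * cosh b)"
    by (intro sums_add sums_mult cosh_converges)
  show "(if even n then q ^ n /\<^sub>R fact n else 0) \<le>
      (1 - v) * (if even n then a ^ n /\<^sub>R fact n else 0) + v * (if even n then b ^ n /\<^sub>R fact n else 0)"
    for n
  proof (cases "even n")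
    case True
    then obtain k where n: "n = 2 * k" by (elim evenE)
    have "(q\<^sup>2) ^ k \<le> ((1 - v) * a\<^sup>2 + v * b\<^sup>2) ^ k"
      using q by (intro power_mono) auto
    also have "\<dots> \<le> (1 - v) * (a\<^sup>2) ^ k + v * (b\<^sup>2) ^ k"
    proof (cases "even k")
      case True
      show ?thesis using convex_onD[OF convex_power_even[OF True], of v "a\<^sup>2" "b\<^sup>2"] v by simp
    next
      case False
      show ?thesis using convex_onD[OF convex_power_odd[OF False], of v "a\<^sup>2" "b\<^sup>2"] v by simp
    qed
    finally have "q ^ n / fact n \<le> ((1 - v) * a ^ n + v * b ^ n) / fact n"
      unfolding n power_mult by (intro divide_right_mono) auto
    then show ?thesis using True by (simp add: field_simps)
  qed simp
qed

text \<open>Termwise comparison of the two series in \<open>x\<^sup>2\<close>, resting on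
  \<open>2 ^ k * fact k \<le> fact (2 * k)\<close>.\<close>

lemma cosh_le_exp_square_half: "cosh x \<le> exp (x\<^sup>2 / 2)" for x :: real
proof -
  have fact_le: "2 ^ k * fact k \<le> (fact (2 * k) :: real)" for k
  proof (induction k)
    case (Suc k)
    have "2 ^ Suc k * fact (Suc k) = (2 * real (Suc k)) * (2 ^ k * fact k :: real)" by simp
    also have "\<dots> \<le> (2 * real (Suc k)) * (1 * fact (2 * k))" using Suc by (intro mult_left_mono) auto
    also have "\<dots> \<le> (2 * real (Suc k)) * ((2 * real k + 1) * fact (2 * k))"
      by (intro mult_left_mono mult_right_mono) auto
    also have "\<dots> = fact (2 * Suc k)" by (simp add: algebra_simps)
    finally show ?case .
  qed simp
  have cosh_sums: "(\<lambda>k. x ^ (2 * k) / fact (2 * k)) sums cosh x"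
  proof -
    have "(\<lambda>n. if even n then x ^ n /\<^sub>R fact n else 0) sums cosh x \<longleftrightarrow>
        (\<lambda>k. if even (2 * k) then x ^ (2 * k) /\<^sub>R fact (2 * k) else 0) sums cosh x"
      by (rule sums_mono_reindex[symmetric]) (auto simp: strict_mono_def elim!: evenE)
    then show ?thesis using cosh_converges[of x] by (simp add: field_simps)
  qed
  have exp_sums: "(\<lambda>k. (x\<^sup>2 / 2) ^ k /\<^sub>R fact k) sums exp (x\<^sup>2 / 2)"
    by (rule exp_converges)
  have "x ^ (2 * k) / fact (2 * k) \<le> (x\<^sup>2 / 2) ^ k /\<^sub>R fact k" for k
  proof -
    have "x ^ (2 * k) / fact (2 * k) \<le> x ^ (2 * k) / (2 ^ k * fact k)"
      using fact_le by (intro divide_left_mono) auto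
    also have "\<dots> = (x\<^sup>2 / 2) ^ k /\<^sub>R fact k"
      unfolding power_divide power_mult[symmetric] real_scaleR_def by (simp add: divide_inverse)
    finally show ?thesis .
  qed
  then show ?thesis by (rule sums_le[OF _ cosh_sums exp_sums])
qed

text \<open>The right-hand side is the chord of \<open>u \<mapsto> cosh (l * sqrt (X\<^sup>2 + c\<^sup>2 + 2 * u))\<close> over the interval
  from \<open>- X * c\<close> to \<open>X * c\<close>; it is affine in \<open>u\<close>, so that the linear term averages out.\<close>

lemma cosh_chord_bound:
  fixes l q X c u :: real
  assumes "0 \<le> X" "0 \<le> c" and u: "\<bar>u\<bar> \<le> X * c" and q: "q\<^sup>2 \<le> X\<^sup>2 + c\<^sup>2 + 2 * u"
  shows "cosh (l * q) \<le> cosh (l * X) * cosh (l * c) + u * (sinh (l * X) * sinh (l * c) / (X * c))"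
proof -
  \<comment> \<open>\<open>v\<close> is the relative position of \<open>u\<close> between
    \<open>- X * c\<close> and \<open>X * c\<close>, where the square
    \<open>X\<^sup>2 + c\<^sup>2 + 2 * u\<close> becomes \<open>(X - c)\<^sup>2\<close> and
    \<open>(X + c)\<^sup>2\<close>. If \<open>X * c = 0\<close>, then \<open>u = 0\<close>, and
    division by zero gives \<open>v = 1/2\<close>, so the identities below persist.\<close>
  define v where "v = (1 + u / (X * c)) / 2"
  have v: "0 \<le> v" "v \<le> 1"
    using u assms(1,2) by (cases "X * c = 0"; auto simp: v_def field_simps abs_le_iff)+
  have uv: "u = (2 * v - 1) * (X * c)"
    using u by (cases "X * c = 0") (auto simp: v_def field_simps)
  have "(l * q)\<^sup>2 \<le> l\<^sup>2 * (X\<^sup>2 + c\<^sup>2 + 2 * u)"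
    unfolding power_mult_distrib by (intro mult_left_mono q) auto
  also have "\<dots> = (1 - v) * (l * X - l * c)\<^sup>2 + v * (l * X + l * c)\<^sup>2"
    unfolding uv by (simp add: power2_eq_square algebra_simps)
  finally have "cosh (l * q) \<le> (1 - v) * cosh (l * X - l * c) + v * cosh (l * X + l * c)"
    by (rule cosh_le_convex_combination[OF v])
  also have "\<dots> = cosh (l * X) * cosh (l * c) + (2 * v - 1) * (sinh (l * X) * sinh (l * c))"
    by (simp add: cosh_add cosh_diff algebra_simps)
  also have "(2 * v - 1) * (sinh (l * X) * sinh (l * c)) =
      u * (sinh (l * X) * sinh (l * c) / (X * c))"
    by (simp add: v_def diff_divide_distrib add_divide_distrib)
  finally show ?thesis .
qed


section \<open>Exponential moments and tails for sums of independent vectors\<close>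

lemma L2_set_sum_le: "L2_set (\<lambda>k. \<Sum>i\<in>I. f i k) K \<le> (\<Sum>i\<in>I. L2_set (f i) K)"
proof (induction I rule: infinite_finite_induct)
  case (insert i I)
  have "L2_set (\<lambda>k. \<Sum>i\<in>insert i I. f i k) K = L2_set (\<lambda>k. f i k + (\<Sum>i\<in>I. f i k)) K"
    using insert by simp
  also have "\<dots> \<le> L2_set (f i) K + L2_set (\<lambda>k. \<Sum>i\<in>I. f i k) K"
    by (rule L2_set_triangle_ineq)
  finally show ?case using insert by simp
qed (simp_all add: L2_set_def)

lemma L2_set_square: "(L2_set f K)\<^sup>2 = (\<Sum>k\<in>K. (f k)\<^sup>2)"
  by (simp add: L2_set_def sum_nonneg)

lemma abs_le_L2_set: "finite K \<Longrightarrow> k \<in> K \<Longrightarrow> \<bar>f k\<bar> \<le> L2_set f K"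
  unfolding L2_set_def
  by (intro real_le_rsqrt) (auto intro: member_le_sum[of k K "\<lambda>k. (f k)\<^sup>2"])

lemma abs_sum_mult_le_L2_set: "\<bar>\<Sum>k\<in>K. f k * g k\<bar> \<le> L2_set f K * L2_set g K"
  using L2_set_mult_ineq[of f g K] sum_abs[of "\<lambda>k. f k * g k" K] by (simp add: abs_mult)

lemma L2_set_add_square:
  "(L2_set (\<lambda>k. f k + g k) K)\<^sup>2 = (L2_set f K)\<^sup>2 + 2 * (\<Sum>k\<in>K. f k * g k) + (L2_set g K)\<^sup>2"
  by (simp add: L2_set_square power2_sum sum.distrib sum_distrib_left algebra_simps)

text \<open>The chord bound is applied with \<open>X\<close> the norm of the earlier summands and
  \<open>u\<close> their inner product with the new one. Its linear term is a finite sum of products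
  of a function of the earlier summands with a centred coordinate of the new one, so independence
  annihilates it without conditional expectations. The integrability in the conclusion serves
  Markov's inequality later.\<close>

lemma (in prob_space) expectation_cosh_L2_set_sum_le:
  fixes X :: "'i \<Rightarrow> 'a \<Rightarrow> 'k \<Rightarrow> real"
  assumes "finite I" "finite K" and l: "0 \<le> l"
    and "indep_vars (\<lambda>_. Pi\<^sub>M K (\<lambda>_. borel)) X I"
    and "\<And>i k. i \<in> I \<Longrightarrow> k \<in> K \<Longrightarrow> expectation (\<lambda>\<omega>. X i \<omega> k) = 0"
    and "\<And>i. i \<in> I \<Longrightarrow> AE \<omega> in M. L2_set (X i \<omega>) K \<le> c i"
    and "\<And>i. i \<in> I \<Longrightarrow> 0 \<le> c i"
  shows "expectation (\<lambda>\<omega>. cosh (l * L2_set (\<lambda>k. \<Sum>i\<in>I. X i \<omega> k) K)) \<le> (\<Prod>i\<in>I. cosh (l * c i)) \<and>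
    integrable M (\<lambda>\<omega>. cosh (l * L2_set (\<lambda>k. \<Sum>i\<in>I. X i \<omega> k) K))"
  using assms(1,4-)
proof (induction I rule: finite_induct)
  case empty
  then show ?case by (simp add: L2_set_def)
next
  case (insert i I)
  note indep = insert.prems(1) and mean = insert.prems(2) and bdd = insert.prems(3) and c = insert.prems(4)
  have X_meas [measurable]: "(\<lambda>\<omega>. X j \<omega> k) \<in> borel_measurable M" if "j \<in> insert i I" "k \<in> K" for j k
  proof -
    have "X j \<in> measurable M (Pi\<^sub>M K (\<lambda>_. borel))"
      using indep that(1) unfolding indep_vars_def by auto
    then show ?thesis
      using measurable_compose[OF _ measurable_component_singleton[OF that(2)]] by blast
  qed
  define x where "x \<omega> k = (\<Sum>j\<in>I. X j \<omega> k)" for \<omega> k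
  define R where "R \<omega> = L2_set (x \<omega>) K" for \<omega>
  define Q where "Q \<omega> = L2_set (\<lambda>k. \<Sum>j\<in>insert i I. X j \<omega> k) K" for \<omega>
  \<comment> \<open>The slope of the chord as a function of the norm \<open>r\<close> of the earlier
    summands.\<close>
  define G where "G r = sinh (l * r) * sinh (l * c i) / (r * c i)" for r
  define B where "B = (\<Sum>j\<in>insert i I. c j)"
  have x_meas [measurable]: "(\<lambda>\<omega>. x \<omega> k) \<in> borel_measurable M" if "k \<in> K" for k
    unfolding x_def using that by measurable
  have R_meas [measurable]: "R \<in> borel_measurable M"
    unfolding R_def L2_set_def by measurable
  have Q_meas [measurable]: "Q \<in> borel_measurable M"
    unfolding Q_def L2_set_def by measurable
  have G_meas [measurable]: "G \<in> borel_measurable borel"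
    unfolding G_def sinh_def by measurable
  have cosh_meas [measurable]: "(\<lambda>t::real. cosh (l * t)) \<in> borel_measurable borel"
    unfolding cosh_def by measurable
  have all_bdd: "AE \<omega> in M. \<forall>j\<in>insert i I. L2_set (X j \<omega>) K \<le> c j"
    using insert.hyps bdd by (intro AE_finite_allI) auto
  have Q_bdd: "AE \<omega> in M. 0 \<le> Q \<omega> \<and> Q \<omega> \<le> B"
    using all_bdd
  proof eventually_elim
    case (elim \<omega>)
    have "Q \<omega> \<le> (\<Sum>j\<in>insert i I. L2_set (X j \<omega>) K)"
      unfolding Q_def by (rule L2_set_sum_le)
    also have "\<dots> \<le> B" unfolding B_def using elim by (intro sum_mono) auto
    finally show ?case by (simp add: Q_def L2_set_nonneg)
  qed
  have R_bdd: "AE \<omega> in M. 0 \<le> R \<omega> \<and> R \<omega> \<le> B"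
    using all_bdd
  proof eventually_elim
    case (elim \<omega>)
    have "R \<omega> \<le> (\<Sum>j\<in>I. L2_set (X j \<omega>) K)"
      unfolding R_def x_def by (rule L2_set_sum_le)
    also have "\<dots> \<le> (\<Sum>j\<in>I. c j)" using elim by (intro sum_mono) auto
    also have "\<dots> \<le> B" unfolding B_def using insert.hyps c by (intro sum_mono2) auto
    finally show ?case by (simp add: R_def L2_set_nonneg)
  qed
  have cosh_int: "integrable M (\<lambda>\<omega>. cosh (l * f \<omega>))"
    if "AE \<omega> in M. 0 \<le> f \<omega> \<and> f \<omega> \<le> B" and [measurable]: "f \<in> borel_measurable M" for f
  proof (rule integrable_const_bound)
    show "AE \<omega> in M. norm (cosh (l * f \<omega>)) \<le> cosh (l * B)"
      using that(1)
    proof eventually_elim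
      case (elim \<omega>)
      then have "0 \<le> l * f \<omega>" "l * f \<omega> \<le> l * B" using l by (auto intro: mult_left_mono)
      then show ?case by (simp add: cosh_real_nonneg_le_iff)
    qed
  qed measurable
  have xG_int: "integrable M (\<lambda>\<omega>. x \<omega> k * G (R \<omega>))" if k: "k \<in> K" for k
  proof (rule integrable_const_bound)
    show "AE \<omega> in M. norm (x \<omega> k * G (R \<omega>)) \<le> sinh (l * B) * sinh (l * c i) / c i"
      using R_bdd
    proof eventually_elim
      case (elim \<omega>)
      have ci: "0 \<le> c i" using c by simp
      have s: "0 \<le> sinh (l * c i)" "0 \<le> sinh (l * R \<omega>)" using l ci elim by auto
      have "norm (x \<omega> k * G (R \<omega>)) = \<bar>x \<omega> k\<bar> * \<bar>G (R \<omega>)\<bar>" by (simp add: abs_mult)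
      \<comment> \<open>The factor \<open>x \<omega> k\<close> is at most \<open>R \<omega>\<close>
        in modulus, which cancels the denominator \<open>r\<close> of \<open>G\<close>; this bounds
        the product even where \<open>R\<close> is close to zero.\<close>
      also have "\<dots> \<le> R \<omega> * \<bar>G (R \<omega>)\<bar>"
        using abs_le_L2_set[OF assms(2) k, of "x \<omega>"] by (intro mult_right_mono) (auto simp: R_def)
      also have "\<dots> \<le> sinh (l * R \<omega>) * sinh (l * c i) / c i"
        using s ci elim by (cases "R \<omega> = 0") (auto simp: G_def abs_mult)
      also have "\<dots> \<le> sinh (l * B) * sinh (l * c i) / c i"
        using s ci elim l by (intro divide_right_mono mult_right_mono) (auto intro: mult_left_mono)
      finally show ?case .
    qed
    show "(\<lambda>\<omega>. x \<omega> k * G (R \<omega>)) \<in> borel_measurable M" using k by measurable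
  qed
  have X_int: "integrable M (\<lambda>\<omega>. X i \<omega> k)" if k: "k \<in> K" for k
  proof (rule integrable_const_bound)
    show "AE \<omega> in M. norm (X i \<omega> k) \<le> c i"
      using bdd[OF insertI1]
    proof eventually_elim
      case (elim \<omega>)
      then show ?case using abs_le_L2_set[OF assms(2) k, of "X i \<omega>"] by simp
    qed
  qed (use k in measurable)
  \<comment> \<open>The first factor depends only on the block \<open>I\<close>, the second only on
    the block \<open>{i}\<close>; disjoint blocks of an independent family are independent, and
    measurable functions preserve this.\<close>
  have ind: "indep_var borel (\<lambda>\<omega>. x \<omega> k * G (R \<omega>)) borel (\<lambda>\<omega>. X i \<omega> k)" if k: "k \<in> K" for k
  proof -
    let ?P = "\<lambda>J. Pi\<^sub>M J (\<lambda>_. Pi\<^sub>M K (\<lambda>_. borel :: real measure))"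
    have comp: "(\<lambda>y. y j k) \<in> borel_measurable (?P J)" if "j \<in> J" "k \<in> K" for j J k
      using measurable_compose[OF measurable_component_singleton[OF that(1)]
          measurable_component_singleton[OF that(2)]] .
    let ?F = "\<lambda>y. (\<Sum>j\<in>I. y j k) * G (L2_set (\<lambda>k. \<Sum>j\<in>I. y j k) K)"
    have "(\<lambda>y. \<Sum>j\<in>I. y j k) \<in> borel_measurable (?P I)" if "k \<in> K" for k
      using that by (intro borel_measurable_sum comp)
    note [measurable] = this
    have F: "?F \<in> borel_measurable (?P I)"
      unfolding L2_set_def using k by measurable
    have "indep_var (?P I) (\<lambda>\<omega>. restrict (\<lambda>i. X i \<omega>) I) (?P {i}) (\<lambda>\<omega>. restrict (\<lambda>i. X i \<omega>) {i})"
      by (rule indep_var_restrict[OF indep]) (use insert.hyps in auto)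
    from indep_var_compose[OF this F comp[OF singletonI k]]
    have "indep_var borel (?F \<circ> (\<lambda>\<omega>. restrict (\<lambda>i. X i \<omega>) I)) borel
        ((\<lambda>y. y i k) \<circ> (\<lambda>\<omega>. restrict (\<lambda>i. X i \<omega>) {i}))" .
    moreover have "?F \<circ> (\<lambda>\<omega>. restrict (\<lambda>i. X i \<omega>) I) = (\<lambda>\<omega>. x \<omega> k * G (R \<omega>))"
      by (auto simp: fun_eq_iff R_def x_def[abs_def])
    moreover have "(\<lambda>y. y i k) \<circ> (\<lambda>\<omega>. restrict (\<lambda>i. X i \<omega>) {i}) = (\<lambda>\<omega>. X i \<omega> k)"
      by (auto simp: fun_eq_iff)
    ultimately show ?thesis by simp
  qed
  have prod_int: "integrable M (\<lambda>\<omega>. x \<omega> k * G (R \<omega>) * X i \<omega> k)"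
    and prod_0: "expectation (\<lambda>\<omega>. x \<omega> k * G (R \<omega>) * X i \<omega> k) = 0" if "k \<in> K" for k
    using indep_var_integrable[OF ind xG_int X_int] indep_var_lebesgue_integral[OF ind xG_int X_int]
      mean[OF insertI1] that by auto
  have chord: "AE \<omega> in M. cosh (l * Q \<omega>) \<le>
      cosh (l * R \<omega>) * cosh (l * c i) + (\<Sum>k\<in>K. x \<omega> k * G (R \<omega>) * X i \<omega> k)"
    using bdd[OF insertI1]
  proof eventually_elim
    case (elim \<omega>)
    let ?u = "\<Sum>k\<in>K. x \<omega> k * X i \<omega> k"
    have "\<bar>?u\<bar> \<le> R \<omega> * L2_set (X i \<omega>) K"
      unfolding R_def by (rule abs_sum_mult_le_L2_set)
    also have "\<dots> \<le> R \<omega> * c i"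
      using elim by (intro mult_left_mono) (auto simp: R_def L2_set_nonneg)
    finally have u: "\<bar>?u\<bar> \<le> R \<omega> * c i" .
    have "Q \<omega> = L2_set (\<lambda>k. x \<omega> k + X i \<omega> k) K"
      unfolding Q_def x_def using insert.hyps by (simp add: add.commute)
    then have "(Q \<omega>)\<^sup>2 = (R \<omega>)\<^sup>2 + 2 * ?u + (L2_set (X i \<omega>) K)\<^sup>2"
      by (simp add: L2_set_add_square R_def)
    also have "\<dots> \<le> (R \<omega>)\<^sup>2 + (c i)\<^sup>2 + 2 * ?u"
      using elim power_mono[OF elim L2_set_nonneg, of 2] by simp
    finally have "cosh (l * Q \<omega>) \<le> cosh (l * R \<omega>) * cosh (l * c i) + ?u * G (R \<omega>)"
      unfolding G_def using u c by (intro cosh_chord_bound) (auto simp: R_def L2_set_nonneg)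
    then show ?case by (simp add: sum_distrib_left mult_ac)
  qed
  note R_int = cosh_int[OF R_bdd R_meas] and Q_int = cosh_int[OF Q_bdd Q_meas]
  have "expectation (\<lambda>\<omega>. cosh (l * Q \<omega>)) \<le>
      expectation (\<lambda>\<omega>. cosh (l * R \<omega>) * cosh (l * c i) + (\<Sum>k\<in>K. x \<omega> k * G (R \<omega>) * X i \<omega> k))"
    by (intro integral_mono_AE chord Q_int Bochner_Integration.integrable_add
        integrable_mult_left R_int Bochner_Integration.integrable_sum prod_int)
  also have "\<dots> = expectation (\<lambda>\<omega>. cosh (l * R \<omega>)) * cosh (l * c i)
      + (\<Sum>k\<in>K. expectation (\<lambda>\<omega>. x \<omega> k * G (R \<omega>) * X i \<omega> k))"
    by (simp add: R_int prod_int)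
  also have "\<dots> = expectation (\<lambda>\<omega>. cosh (l * R \<omega>)) * cosh (l * c i)"
    by (simp add: prod_0)
  also have "\<dots> \<le> (\<Prod>j\<in>I. cosh (l * c j)) * cosh (l * c i)"
  proof (rule mult_right_mono)
    show "expectation (\<lambda>\<omega>. cosh (l * R \<omega>)) \<le> (\<Prod>j\<in>I. cosh (l * c j))"
      unfolding R_def x_def
      using insert.IH[OF indep_vars_subset[OF indep]] mean bdd c by auto
  qed simp
  finally have "expectation (\<lambda>\<omega>. cosh (l * Q \<omega>)) \<le> (\<Prod>j\<in>insert i I. cosh (l * c j))"
    using insert.hyps by (simp add: mult.commute)
  then show ?case using Q_int unfolding Q_def by blast
qed

text \<open>The bound does not depend on the number of coordinates in \<open>K\<close>, which is
  what allows the passage to L2 norms.\<close>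

theorem (in prob_space) Hoeffding_L2_set:
  fixes X :: "'i \<Rightarrow> 'a \<Rightarrow> 'k \<Rightarrow> real"
  assumes "finite I" "finite K"
    and "indep_vars (\<lambda>_. Pi\<^sub>M K (\<lambda>_. borel)) X I"
    and "\<And>i k. i \<in> I \<Longrightarrow> k \<in> K \<Longrightarrow> expectation (\<lambda>\<omega>. X i \<omega> k) = 0"
    and "\<And>i. i \<in> I \<Longrightarrow> AE \<omega> in M. L2_set (X i \<omega>) K \<le> c i"
    and "\<And>i. i \<in> I \<Longrightarrow> 0 \<le> c i"
    and b: "0 < L2_set c I" and \<delta>: "0 < \<delta>"
  shows "prob {\<omega>\<in>space M. \<delta> * L2_set c I < L2_set (\<lambda>k. \<Sum>i\<in>I. X i \<omega> k) K} \<le> 2 * exp (- \<delta>\<^sup>2 / 2)"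
proof -
  \<comment> \<open>Writing \<open>b\<close> for \<open>L2_set c I\<close>, this \<open>l\<close>
    minimises \<open>l\<^sup>2 * b\<^sup>2 / 2 - l * \<delta> * b\<close>. It makes the moment bound
    \<open>exp (\<delta>\<^sup>2 / 2)\<close> and sends the threshold \<open>\<delta> * b\<close> to
    \<open>\<delta>\<^sup>2\<close>.\<close>
  define l where "l = \<delta> / L2_set c I"
  have l: "0 < l" using b \<delta> by (simp add: l_def)
  let ?Q = "\<lambda>\<omega>. L2_set (\<lambda>k. \<Sum>i\<in>I. X i \<omega> k) K"
  have E: "expectation (\<lambda>\<omega>. cosh (l * ?Q \<omega>)) \<le> (\<Prod>i\<in>I. cosh (l * c i))"
    and int: "integrable M (\<lambda>\<omega>. cosh (l * ?Q \<omega>))"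
    using expectation_cosh_L2_set_sum_le[OF assms(1,2) less_imp_le[OF l] assms(3-6)] by auto
  have "(\<Prod>i\<in>I. cosh (l * c i)) \<le> (\<Prod>i\<in>I. exp ((l * c i)\<^sup>2 / 2))"
    by (intro prod_mono) (auto intro: cosh_le_exp_square_half)
  also have "\<dots> = exp (l\<^sup>2 * (L2_set c I)\<^sup>2 / 2)"
    using assms(1) by (simp add: exp_sum[symmetric] L2_set_square power_mult_distrib
        sum_distrib_left sum_divide_distrib)
  also have "l\<^sup>2 * (L2_set c I)\<^sup>2 = \<delta>\<^sup>2"
    using b by (simp add: l_def power_divide)
  finally have E': "expectation (\<lambda>\<omega>. cosh (l * ?Q \<omega>)) \<le> exp (\<delta>\<^sup>2 / 2)"
    using E by linarith
  have "prob {\<omega>\<in>space M. \<delta> * L2_set c I < ?Q \<omega>} \<le> prob {\<omega>\<in>space M. cosh (\<delta>\<^sup>2) \<le> cosh (l * ?Q \<omega>)}"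
  proof (rule finite_measure_mono)
    show "{\<omega>\<in>space M. cosh (\<delta>\<^sup>2) \<le> cosh (l * ?Q \<omega>)} \<in> events"
      using borel_measurable_integrable[OF int] by measurable
    have "\<delta>\<^sup>2 \<le> l * q" if "\<delta> * L2_set c I < q" for q
    proof -
      have "\<delta>\<^sup>2 = l * (\<delta> * L2_set c I)" using b by (simp add: l_def power2_eq_square)
      also have "\<dots> \<le> l * q" using that l by (intro mult_left_mono) auto
      finally show ?thesis .
    qed
    then show "{\<omega>\<in>space M. \<delta> * L2_set c I < ?Q \<omega>} \<subseteq> {\<omega>\<in>space M. cosh (\<delta>\<^sup>2) \<le> cosh (l * ?Q \<omega>)}"
      using l by (auto simp: cosh_real_nonneg_le_iff L2_set_nonneg)
  qed
  also have "\<dots> \<le> expectation (\<lambda>\<omega>. cosh (l * ?Q \<omega>)) / cosh (\<delta>\<^sup>2)"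
    by (rule integral_Markov_inequality_measure[OF int, of "{}"]) auto
  also have "\<dots> \<le> exp (\<delta>\<^sup>2 / 2) / (exp (\<delta>\<^sup>2) / 2)"
  proof (rule frac_le)
    show "exp (\<delta>\<^sup>2) / 2 \<le> cosh (\<delta>\<^sup>2)" by (simp add: cosh_def)
  qed (use E' in auto)
  also have "\<dots> = 2 * exp (\<delta>\<^sup>2 / 2 - \<delta>\<^sup>2)" by (simp only: exp_diff) simp
  finally show ?thesis by simp
qed

section \<open>Hoeffding's inequality for the L2 norm\<close>

lemma l2_norm_sum_le:
  "(\<And>i. i \<in> I \<Longrightarrow> f i \<in> L2 \<mu>) \<Longrightarrow> l2_norm \<mu> (\<lambda>x. \<Sum>i\<in>I. f i x) \<le> (\<Sum>i\<in>I. l2_norm \<mu> (f i))"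
proof (induction I rule: infinite_finite_induct)
  case (insert i I)
  then show ?case
    using l2_norm_triangle[of "f i" \<mu> "\<lambda>x. \<Sum>i\<in>I. f i x"] by (force intro: L2_sum)
qed (simp_all add: l2_norm_def)

text \<open>Independence is expressed through the coordinates \<open>l2_inner \<mu> (\<epsilon> \<omega> i) h\<close>; the norm of the sum
  becomes accessible as the limit of its Bessel sums, so no measurability of \<open>\<omega> \<mapsto> \<epsilon> \<omega> i\<close> beyond that
  of the coordinates is required.\<close>

theorem (in prob_space) Hoeffding_l2_norm:
  fixes \<epsilon> :: "'a \<Rightarrow> 'i \<Rightarrow> 'x \<Rightarrow> real" and e :: "nat \<Rightarrow> 'j \<Rightarrow> 'x \<Rightarrow> real"
  assumes e: "\<And>n. l2_orthonormal \<mu> (J n) (e n)"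
    and exhaust: "\<And>f. f \<in> L2 \<mu> \<Longrightarrow> (\<lambda>n. \<Sum>j\<in>J n. (l2_inner \<mu> f (e n j))\<^sup>2) \<longlonglongrightarrow> (l2_norm \<mu> f)\<^sup>2"
    and I: "finite I"
    and L2: "\<And>i \<omega>. i \<in> I \<Longrightarrow> \<omega> \<in> space M \<Longrightarrow> \<epsilon> \<omega> i \<in> L2 \<mu>"
    and indep: "indep_vars (\<lambda>_. Pi\<^sub>M (L2 \<mu>) (\<lambda>_. borel)) (\<lambda>i \<omega>. \<lambda>h\<in>L2 \<mu>. l2_inner \<mu> (\<epsilon> \<omega> i) h) I"
    and mean: "\<And>i h. i \<in> I \<Longrightarrow> h \<in> L2 \<mu> \<Longrightarrow> expectation (\<lambda>\<omega>. l2_inner \<mu> (\<epsilon> \<omega> i) h) = 0"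
    and bdd: "\<And>i. i \<in> I \<Longrightarrow> AE \<omega> in M. l2_norm \<mu> (\<epsilon> \<omega> i) \<le> \<sigma>"
    and \<sigma>: "0 \<le> \<sigma>" and \<delta>: "0 < \<delta>"
  shows "\<exists>A\<in>events. 1 - 2 * exp (- \<delta>\<^sup>2 / 2) \<le> prob A \<and>
    (\<forall>\<omega>\<in>A. l2_norm \<mu> (\<lambda>x. \<Sum>i\<in>I. w i * \<epsilon> \<omega> i x) \<le> \<delta> * (\<sigma> * L2_set w I))"
proof (cases "\<sigma> * L2_set w I = 0")
  \<comment> \<open>The finite-dimensional bound divides by the total size of the summands, so this
    degenerate case is separate: every term has norm zero almost surely.\<close>
  case True
  then have zero: "\<bar>w i\<bar> * \<sigma> = 0" if "i \<in> I" for i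
    using that I abs_le_L2_set[of I i w] by auto
  have "AE \<omega> in M. \<forall>i\<in>I. l2_norm \<mu> (\<epsilon> \<omega> i) \<le> \<sigma>"
    using I bdd by (intro AE_finite_allI) auto
  then have "AE \<omega> in M. l2_norm \<mu> (\<lambda>x. \<Sum>i\<in>I. w i * \<epsilon> \<omega> i x) \<le> 0"
    using AE_space
  proof eventually_elim
    case (elim \<omega>)
    have "l2_norm \<mu> (\<lambda>x. \<Sum>i\<in>I. w i * \<epsilon> \<omega> i x) \<le> (\<Sum>i\<in>I. l2_norm \<mu> (\<lambda>x. w i * \<epsilon> \<omega> i x))"
      using elim by (intro l2_norm_sum_le L2_cmult L2) auto
    also have "\<dots> \<le> (\<Sum>i\<in>I. \<bar>w i\<bar> * \<sigma>)"
      unfolding l2_norm_cmult using elim by (intro sum_mono mult_left_mono) auto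
    also have "\<dots> = 0" by (intro sum.neutral ballI zero)
    finally show ?case .
  qed
  then obtain A where A: "A \<subseteq> {\<omega>\<in>space M. l2_norm \<mu> (\<lambda>x. \<Sum>i\<in>I. w i * \<epsilon> \<omega> i x) \<le> 0}"
    "A \<in> events" "prob A = 1"
    using AE_E_prob by blast
  then show ?thesis using True by (intro bexI[of _ A]) auto
next
  case False
  define r where "r = \<delta> * (\<sigma> * L2_set w I)"
  have pos: "0 < \<sigma> * L2_set w I" using False \<sigma> L2_set_nonneg[of w I] by (simp add: less_eq_real_def)
  define S where "S \<omega> x = (\<Sum>i\<in>I. w i * \<epsilon> \<omega> i x)" for \<omega> x
  have S_L2: "S \<omega> \<in> L2 \<mu>" if "\<omega> \<in> space M" for \<omega>
    unfolding S_def using that by (intro L2_sum L2_cmult L2)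
  have eL2: "e n j \<in> L2 \<mu>" if "j \<in> J n" for n j
    using e[of n] that by (auto simp: l2_orthonormal_def)
  have J: "finite (J n)" for n using e[of n] by (auto simp: l2_orthonormal_def)
  have inner_meas [measurable]: "(\<lambda>\<omega>. l2_inner \<mu> (\<epsilon> \<omega> i) h) \<in> borel_measurable M"
    if "i \<in> I" "h \<in> L2 \<mu>" for i h
  proof -
    have "(\<lambda>\<omega>. \<lambda>h\<in>L2 \<mu>. l2_inner \<mu> (\<epsilon> \<omega> i) h) \<in> measurable M (Pi\<^sub>M (L2 \<mu>) (\<lambda>_. borel))"
      using indep that(1) by (auto simp: indep_vars_def)
    from measurable_compose[OF this measurable_component_singleton[OF that(2)]]
    show ?thesis using that(2) by simp
  qed
  define V where "V n \<omega> = L2_set (\<lambda>k. \<Sum>i\<in>I. w i * l2_inner \<mu> (\<epsilon> \<omega> i) (e n k)) (J n)" for n \<omega>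
  have V_meas [measurable]: "V n \<in> borel_measurable M" for n
    unfolding V_def L2_set_def using eL2 by measurable
  define bad where "bad n = {\<omega>\<in>space M. r < V n \<omega>}" for n
  have bad_event [measurable]: "bad n \<in> events" for n unfolding bad_def by measurable
  have bad_prob: "prob (bad n) \<le> 2 * exp (- \<delta>\<^sup>2 / 2)" for n
  proof -
    define X where "X i \<omega> = (\<lambda>k\<in>J n. w i * l2_inner \<mu> (\<epsilon> \<omega> i) (e n k))" for i \<omega>
    define c where "c i = \<bar>w i\<bar> * \<sigma>" for i
    have c_set: "L2_set c I = \<sigma> * L2_set w I"
    proof -
      have "L2_set c I = L2_set (\<lambda>i. \<sigma> * w i) I"
        by (simp add: L2_set_def c_def power_mult_distrib mult.commute)
      then show ?thesis using \<sigma> by (simp add: L2_set_right_distrib)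
    qed
    \<comment> \<open>The weighted coordinates in the finite system are a measurable image of the
      full coordinate family, so they inherit its independence.\<close>
    have "indep_vars (\<lambda>_. Pi\<^sub>M (J n) (\<lambda>_. borel))
        (\<lambda>i \<omega>. (\<lambda>y. \<lambda>k\<in>J n. w i * y (e n k)) (\<lambda>h\<in>L2 \<mu>. l2_inner \<mu> (\<epsilon> \<omega> i) h)) I"
    proof (rule indep_vars_compose2[OF indep])
      show "(\<lambda>y. \<lambda>k\<in>J n. w i * y (e n k)) \<in> measurable (Pi\<^sub>M (L2 \<mu>) (\<lambda>_. borel)) (Pi\<^sub>M (J n) (\<lambda>_. borel))" for i
        by (intro measurable_restrict borel_measurable_times borel_measurable_const
            measurable_component_singleton eL2)
    qed
    moreover have "(\<lambda>i \<omega>. (\<lambda>y. \<lambda>k\<in>J n. w i * y (e n k)) (\<lambda>h\<in>L2 \<mu>. l2_inner \<mu> (\<epsilon> \<omega> i) h)) = X"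
      using eL2 by (auto simp: X_def fun_eq_iff restrict_def)
    ultimately have X_indep: "indep_vars (\<lambda>_. Pi\<^sub>M (J n) (\<lambda>_. borel)) X I" by simp
    have "prob {\<omega>\<in>space M. \<delta> * L2_set c I < L2_set (\<lambda>k. \<Sum>i\<in>I. X i \<omega> k) (J n)} \<le> 2 * exp (- \<delta>\<^sup>2 / 2)"
    proof (rule Hoeffding_L2_set[OF I J X_indep])
      show "expectation (\<lambda>\<omega>. X i \<omega> k) = 0" if "i \<in> I" "k \<in> J n" for i k
        using that mean[OF that(1) eL2[OF that(2)]] by (simp add: X_def)
      show "AE \<omega> in M. L2_set (X i \<omega>) (J n) \<le> c i" if i: "i \<in> I" for i
        using bdd[OF i] AE_space
      proof eventually_elim
        case (elim \<omega>)
        have "L2_set (X i \<omega>) (J n) = L2_set (\<lambda>k. \<bar>w i\<bar> * l2_inner \<mu> (\<epsilon> \<omega> i) (e n k)) (J n)"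
          by (simp add: L2_set_def X_def power_mult_distrib)
        also have "\<dots> = \<bar>w i\<bar> * L2_set (\<lambda>k. l2_inner \<mu> (\<epsilon> \<omega> i) (e n k)) (J n)"
          by (simp add: L2_set_right_distrib)
        also have "\<dots> \<le> \<bar>w i\<bar> * l2_norm \<mu> (\<epsilon> \<omega> i)"
          using l2_Bessel[OF e L2[OF i elim(2)], of n]
          by (intro mult_left_mono) (auto simp: L2_set_def real_le_lsqrt l2_norm_nonneg)
        also have "\<dots> \<le> c i" unfolding c_def using elim by (intro mult_left_mono) auto
        finally show ?case .
      qed
    qed (use \<sigma> pos \<delta> c_set in \<open>auto simp: c_def\<close>)
    moreover have "L2_set (\<lambda>k. \<Sum>i\<in>I. X i \<omega> k) (J n) = V n \<omega>" for \<omega>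
      unfolding V_def by (intro L2_set_cong) (auto simp: X_def)
    ultimately show ?thesis by (simp add: bad_def r_def c_set)
  qed
  \<comment> \<open>The events \<open>bad n\<close> need not be monotone. A sum with norm above
    \<open>r\<close> lies in \<open>bad n\<close> for all large \<open>n\<close>, hence in the
    increasing union of the \<open>G k\<close>, each of which is contained in \<open>bad k\<close>;
    continuity from below keeps the bound.\<close>
  define G where "G k = (\<Inter>n\<in>{k..}. bad n)" for k :: nat
  have G_event [measurable]: "G k \<in> events" for k
    unfolding G_def by (intro sets.countable_INT') auto
  have "(\<lambda>k. prob (G k)) \<longlonglongrightarrow> prob (\<Union>k. G k)"
    by (intro finite_Lim_measure_incseq) (auto simp: G_def incseq_def)
  moreover have "prob (G k) \<le> 2 * exp (- \<delta>\<^sup>2 / 2)" for k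
  proof -
    have "prob (G k) \<le> prob (bad k)" by (intro finite_measure_mono) (auto simp: G_def)
    with bad_prob[of k] show ?thesis by linarith
  qed
  ultimately have "prob (\<Union>k. G k) \<le> 2 * exp (- \<delta>\<^sup>2 / 2)"
    by (intro LIMSEQ_le_const2) auto
  then have "1 - 2 * exp (- \<delta>\<^sup>2 / 2) \<le> prob (space M - (\<Union>k. G k))"
    by (subst prob_compl) auto
  moreover have "l2_norm \<mu> (S \<omega>) \<le> r" if \<omega>: "\<omega> \<in> space M - (\<Union>k. G k)" for \<omega>
  proof (rule ccontr)
    assume "\<not> l2_norm \<mu> (S \<omega>) \<le> r"
    moreover have r0: "0 < r" using pos \<delta> by (simp add: r_def)
    ultimately have "r\<^sup>2 < (l2_norm \<mu> (S \<omega>))\<^sup>2" by (intro power_strict_mono) auto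
    moreover have "l2_inner \<mu> (S \<omega>) (e n k) = (\<Sum>i\<in>I. w i * l2_inner \<mu> (\<epsilon> \<omega> i) (e n k))" if "k \<in> J n" for n k
      unfolding S_def using \<omega> eL2[OF that]
      by (subst l2_inner_sum_left) (auto simp: L2_cmult L2 l2_inner_cmult_left)
    then have "(\<Sum>k\<in>J n. (l2_inner \<mu> (S \<omega>) (e n k))\<^sup>2) = (V n \<omega>)\<^sup>2" for n
      by (simp add: V_def L2_set_square)
    then have "(\<lambda>n. (V n \<omega>)\<^sup>2) \<longlonglongrightarrow> (l2_norm \<mu> (S \<omega>))\<^sup>2"
      using exhaust[OF S_L2, of \<omega>] \<omega> by simp
    ultimately have "\<forall>\<^sub>F n in sequentially. r\<^sup>2 < (V n \<omega>)\<^sup>2"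
      by (intro order_tendstoD)
    then obtain k where "\<forall>n\<ge>k. r\<^sup>2 < (V n \<omega>)\<^sup>2" by (auto simp: eventually_sequentially)
    then have "\<forall>n\<ge>k. r < V n \<omega>"
      using power_less_imp_less_base[of r 2] by (auto simp: V_def L2_set_nonneg)
    then have "\<omega> \<in> G k" using \<omega> by (auto simp: G_def bad_def)
    with \<omega> show False by blast
  qed
  ultimately show ?thesis
    unfolding S_def r_def by (intro bexI[of _ "space M - (\<Union>k. G k)"]) auto
qed

section \<open>The bias terms\<close>

text \<open>The integration step common to both bias terms: a pointwise Cauchy-Schwarz estimate over
  the finite index, whose second factor \<open>K\<close> is constant in \<open>x\<close>, is
  integrated and the constant pulled out.\<close>

lemma l2_norm_le_sqrt_sum_mult:
  fixes f :: "'x \<Rightarrow> real"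
  assumes meas: "f \<in> borel_measurable \<mu>" and u: "\<And>t. t \<in> T \<Longrightarrow> integrable \<mu> (u t)"
    and le: "AE x in \<mu>. (f x)\<^sup>2 \<le> (\<Sum>t\<in>T. u t x) * K"
  shows "f \<in> L2 \<mu>" and "l2_norm \<mu> f \<le> sqrt (\<Sum>t\<in>T. \<integral>x. u t x \<partial>\<mu>) * sqrt K"
proof -
  have int: "integrable \<mu> (\<lambda>x. (\<Sum>t\<in>T. u t x) * K)"
    by (intro integrable_mult_left Bochner_Integration.integrable_sum u)
  show "f \<in> L2 \<mu>"
    unfolding L2_def
  proof (intro CollectI conjI meas Bochner_Integration.integrable_bound[OF int])
    show "AE x in \<mu>. norm ((f x)\<^sup>2) \<le> norm ((\<Sum>t\<in>T. u t x) * K)"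
      using le by eventually_elim auto
  qed (use meas in measurable)
  then have "(\<integral>x. (f x)\<^sup>2 \<partial>\<mu>) \<le> (\<integral>x. (\<Sum>t\<in>T. u t x) * K \<partial>\<mu>)"
    by (intro integral_mono_AE int le L2_integrable_square)
  also have "\<dots> = (\<Sum>t\<in>T. \<integral>x. u t x \<partial>\<mu>) * K"
    using u by simp
  finally show "l2_norm \<mu> f \<le> sqrt (\<Sum>t\<in>T. \<integral>x. u t x \<partial>\<mu>) * sqrt K"
    by (simp add: l2_norm_def flip: real_sqrt_mult)
qed

text \<open>Fubini's theorem for the kernel. Sections are square-integrable only for almost every
  \<open>x\<close>, which is why the linearity of \<open>l2_inner \<mu> (\<beta> x)\<close> is used
  only almost everywhere later.\<close>

lemma
  assumes "sigma_finite_measure \<mu>" and \<beta>: "\<beta> \<in> L2_kernel \<mu>"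
  shows L2_kernel_section: "AE x in \<mu>. \<beta> x \<in> L2 \<mu>"
    and L2_kernel_integrable: "integrable \<mu> (\<lambda>x. (l2_norm \<mu> (\<beta> x))\<^sup>2)"
    and hs_norm_square: "(hs_norm \<mu> \<beta>)\<^sup>2 = (\<integral>x. (l2_norm \<mu> (\<beta> x))\<^sup>2 \<partial>\<mu>)"
    and L2_kernel_inner_measurable:
      "g \<in> borel_measurable \<mu> \<Longrightarrow> (\<lambda>x. l2_inner \<mu> (\<beta> x) g) \<in> borel_measurable \<mu>"
proof -
  interpret sigma_finite_measure \<mu> by fact
  interpret pair_sigma_finite \<mu> \<mu> ..
  have meas [measurable]: "case_prod \<beta> \<in> borel_measurable (\<mu> \<Otimes>\<^sub>M \<mu>)"
    and int: "integrable (\<mu> \<Otimes>\<^sub>M \<mu>) (\<lambda>(x, y). (\<beta> x y)\<^sup>2)"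
    using \<beta> by (auto simp: L2_kernel_def)
  have sect: "\<beta> x \<in> borel_measurable \<mu>" if "x \<in> space \<mu>" for x
    using measurable_compose[OF measurable_Pair1'[OF that] meas] by simp
  have "AE x in \<mu>. integrable \<mu> (\<lambda>y. (\<beta> x y)\<^sup>2)"
    using AE_integrable_fst'[OF int] by simp
  then show "AE x in \<mu>. \<beta> x \<in> L2 \<mu>"
    using AE_space by eventually_elim (auto simp: L2_def sect)
  show "integrable \<mu> (\<lambda>x. (l2_norm \<mu> (\<beta> x))\<^sup>2)"
    using integrable_fst'[OF int] by (simp add: l2_norm_def)
  show "(hs_norm \<mu> \<beta>)\<^sup>2 = (\<integral>x. (l2_norm \<mu> (\<beta> x))\<^sup>2 \<partial>\<mu>)"
    by (simp add: hs_norm_def l2_norm_def)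
  assume [measurable]: "g \<in> borel_measurable \<mu>"
  show "(\<lambda>x. l2_inner \<mu> (\<beta> x) g) \<in> borel_measurable \<mu>"
    unfolding l2_inner_def by measurable
qed

text \<open>Cauchy-Schwarz twice at almost every \<open>x\<close>, first inside each inner product
  and then over \<open>t\<close>; integrating the squared section norms produces the Hilbert-Schmidt
  norms.\<close>

lemma l2_norm_sum_kernel_le:
  assumes "sigma_finite_measure \<mu>" and T: "finite T"
    and \<beta>: "\<And>t. t \<in> T \<Longrightarrow> \<beta> t \<in> L2_kernel \<mu>" and g: "\<And>t. t \<in> T \<Longrightarrow> g t \<in> L2 \<mu>"
  shows "(\<lambda>x. \<Sum>t\<in>T. l2_inner \<mu> (\<beta> t x) (g t)) \<in> L2 \<mu>"
    and "l2_norm \<mu> (\<lambda>x. \<Sum>t\<in>T. l2_inner \<mu> (\<beta> t x) (g t)) \<le>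
      sqrt (\<Sum>t\<in>T. (hs_norm \<mu> (\<beta> t))\<^sup>2) * sqrt (\<Sum>t\<in>T. (l2_norm \<mu> (g t))\<^sup>2)"
proof -
  let ?f = "\<lambda>x. \<Sum>t\<in>T. l2_inner \<mu> (\<beta> t x) (g t)" and ?u = "\<lambda>t x. (l2_norm \<mu> (\<beta> t x))\<^sup>2"
  have meas: "?f \<in> borel_measurable \<mu>"
    by (intro borel_measurable_sum L2_kernel_inner_measurable[OF assms(1)] \<beta> L2_measurable[OF g])
  have "AE x in \<mu>. \<forall>t\<in>T. \<beta> t x \<in> L2 \<mu>"
    using T L2_kernel_section[OF assms(1) \<beta>] by (intro AE_finite_allI) auto
  then have le: "AE x in \<mu>. (?f x)\<^sup>2 \<le> (\<Sum>t\<in>T. ?u t x) * (\<Sum>t\<in>T. (l2_norm \<mu> (g t))\<^sup>2)"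
  proof eventually_elim
    case (elim x)
    have "\<bar>?f x\<bar> \<le> (\<Sum>t\<in>T. l2_norm \<mu> (\<beta> t x) * l2_norm \<mu> (g t))"
      using elim g by (intro order_trans[OF sum_abs] sum_mono l2_Cauchy_Schwarz) auto
    then have "(?f x)\<^sup>2 \<le> (\<Sum>t\<in>T. l2_norm \<mu> (\<beta> t x) * l2_norm \<mu> (g t))\<^sup>2"
      by (metis abs_ge_zero power2_abs power_mono)
    also have "\<dots> \<le> (\<Sum>t\<in>T. ?u t x) * (\<Sum>t\<in>T. (l2_norm \<mu> (g t))\<^sup>2)"
      by (rule Cauchy_Schwarz_ineq_sum)
    finally show ?case .
  qed
  note u = L2_kernel_integrable[OF assms(1) \<beta>]
  show "?f \<in> L2 \<mu>" by (rule l2_norm_le_sqrt_sum_mult(1)[OF meas u le])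
  have "(\<Sum>t\<in>T. (hs_norm \<mu> (\<beta> t))\<^sup>2) = (\<Sum>t\<in>T. \<integral>x. ?u t x \<partial>\<mu>)"
    by (intro sum.cong refl hs_norm_square[OF assms(1) \<beta>])
  then show "l2_norm \<mu> ?f \<le> sqrt (\<Sum>t\<in>T. (hs_norm \<mu> (\<beta> t))\<^sup>2) * sqrt (\<Sum>t\<in>T. (l2_norm \<mu> (g t))\<^sup>2)"
    using l2_norm_le_sqrt_sum_mult(2)[OF meas u le] by simp
qed

lemma l2_norm_linear_combination_le:
  assumes \<eta>: "\<And>l. l \<in> L \<Longrightarrow> \<eta> l \<in> L2 \<mu>"
  shows "l2_norm \<mu> (\<lambda>x. \<Sum>l\<in>L. \<eta> l x * z l) \<le>
    sqrt (\<Sum>l\<in>L. (l2_norm \<mu> (\<eta> l))\<^sup>2) * sqrt (\<Sum>l\<in>L. (z l)\<^sup>2)"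
proof -
  have "l2_norm \<mu> (\<lambda>x. \<Sum>l\<in>L. \<eta> l x * z l) \<le>
      sqrt (\<Sum>l\<in>L. \<integral>x. (\<eta> l x)\<^sup>2 \<partial>\<mu>) * sqrt (\<Sum>l\<in>L. (z l)\<^sup>2)"
  proof (rule l2_norm_le_sqrt_sum_mult(2))
    show "(\<lambda>x. \<Sum>l\<in>L. \<eta> l x * z l) \<in> borel_measurable \<mu>"
      by (intro borel_measurable_sum borel_measurable_times borel_measurable_const L2_measurable \<eta>)
  qed (auto intro!: L2_integrable_square \<eta> Cauchy_Schwarz_ineq_sum)
  then show ?thesis by (simp add: l2_norm_def)
qed

section \<open>The error bound\<close>

theorem theoremB1:
  fixes \<mu> :: "real measure"
    and \<Psi> :: "'m::metric_space \<Rightarrow> real \<Rightarrow> real"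
    and M :: "'w measure"
    and N T0 p :: nat
    and YN0 :: "nat \<Rightarrow> nat \<Rightarrow> real \<Rightarrow> real"
    and YNT :: "'w \<Rightarrow> nat \<Rightarrow> real \<Rightarrow> real"
    and Z :: "nat \<Rightarrow> nat \<Rightarrow> real"
    and \<beta> :: "nat \<Rightarrow> real \<Rightarrow> real \<Rightarrow> real"
    and \<eta> :: "nat \<Rightarrow> real \<Rightarrow> real"
    and \<epsilon> :: "'w \<Rightarrow> nat \<Rightarrow> real \<Rightarrow> real"
    and \<gamma> :: "nat \<Rightarrow> real"
    and \<sigma> \<delta> :: real
  assumes space: "(\<exists>a b. a < b \<and> \<mu> = lebesgue_on {a..b})
                  \<or> (\<exists>d::nat. 1 \<le> d \<and> \<mu> = count_space (real ` {1..d}))"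
    and Psi_H: "\<And>a. \<Psi> a \<in> L2 \<mu>"
    and Psi_isometry: "\<And>a b. dist a b = l2_norm \<mu> (\<lambda>x. \<Psi> a x - \<Psi> b x)"
    and Y_closed: "l2_closed \<mu> (range \<Psi>)"
    and Y_convex: "l2_convex \<mu> (range \<Psi>)"
    and T0: "1 \<le> T0"
    and YN0_Y: "\<And>i t. i \<in> {1..N} \<Longrightarrow> t \<in> {1..T0} \<Longrightarrow> YN0 i t \<in> range \<Psi>"
    and YNT_Y: "\<And>i. i \<in> {1..N} \<Longrightarrow> AE \<omega> in M. YNT \<omega> i \<in> range \<Psi>"
    and beta: "\<And>t. t \<in> {1..T0} \<Longrightarrow> \<beta> t \<in> L2_kernel \<mu>"
    and eta: "\<And>l. l \<in> {1..p} \<Longrightarrow> \<eta> l \<in> L2 \<mu>"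
    and model: "\<And>i. i \<in> {1..N} \<Longrightarrow> AE \<omega> in M. AE x in \<mu>.
                  YNT \<omega> i x = (\<Sum>t\<in>{1..T0}. l2_inner \<mu> (\<beta> t x) (YN0 i t))
                              + (\<Sum>l\<in>{1..p}. \<eta> l x * Z i l) + \<epsilon> \<omega> i x"
    and prob: "prob_space M"
    and eps_H: "\<And>i \<omega>. i \<in> {1..N} \<Longrightarrow> \<omega> \<in> space M \<Longrightarrow> \<epsilon> \<omega> i \<in> L2 \<mu>"
    and eps_indep: "prob_space.indep_vars M (\<lambda>_. Pi\<^sub>M (L2 \<mu>) (\<lambda>_. borel))
                      (\<lambda>i \<omega>. \<lambda>h\<in>L2 \<mu>. l2_inner \<mu> (\<epsilon> \<omega> i) h) {1..N}"
    and eps_mean0: "\<And>i h. i \<in> {1..N} \<Longrightarrow> h \<in> L2 \<mu> \<Longrightarrow>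
                      (\<integral>\<omega>. l2_inner \<mu> (\<epsilon> \<omega> i) h \<partial>M) = 0"
    and eps_bdd: "\<And>i. i \<in> {1..N} \<Longrightarrow> AE \<omega> in M. l2_norm \<mu> (\<epsilon> \<omega> i) \<le> \<sigma>"
    and gamma: "(\<Sum>i\<in>{2..N}. \<gamma> i) = 1"
    and delta: "\<delta> > 0"
  shows "\<exists>A\<in>sets M. measure M A \<ge> 1 - 2 * exp (- (\<delta>\<^sup>2) / 2) \<and>
           (\<forall>\<omega>\<in>A.
              dist (inv \<Psi> (YNT \<omega> 1)) (weighting_estimator \<mu> \<Psi> N \<gamma> (YNT \<omega>))
              \<le> sqrt (\<Sum>t\<in>{1..T0}. (hs_norm \<mu> (\<beta> t))\<^sup>2)
                  * sqrt (\<Sum>t\<in>{1..T0}. (l2_norm \<mu> (\<lambda>x. YN0 1 t x - (\<Sum>i\<in>{2..N}. \<gamma> i * YN0 i t x)))\<^sup>2)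
                + sqrt (\<Sum>l\<in>{1..p}. (l2_norm \<mu> (\<eta> l))\<^sup>2)
                  * sqrt (\<Sum>l\<in>{1..p}. (Z 1 l - (\<Sum>i\<in>{2..N}. \<gamma> i * Z i l))\<^sup>2)
                + \<delta> * \<sigma> * (1 + sqrt (\<Sum>i\<in>{2..N}. (\<gamma> i)\<^sup>2)))"
proof -
  interpret prob_space M by (rule prob)
  have fin: "finite_measure \<mu>"
    using space finite_measure_lebesgue_on_interval by (auto intro: finite_measure_count_space)
  then have sf: "sigma_finite_measure \<mu>" by (simp add: finite_measure.axioms)
  \<comment> \<open>Otherwise the sum over \<open>{2..N}\<close> is empty and cannot equal
    1.\<close>
  have N: "2 \<le> N" using gamma by (cases "2 \<le> N") auto
  define w where "w i = (if i = 1 then 1 else - \<gamma> i)" for i :: nat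
  have split: "{1..N} = insert 1 {2..N}" using N by auto
  have w_sum: "(\<Sum>i\<in>{1..N}. w i * z i) = z 1 - (\<Sum>i\<in>{2..N}. \<gamma> i * z i)" for z :: "nat \<Rightarrow> real"
  proof -
    have "(\<Sum>i\<in>{2..N}. w i * z i) = (\<Sum>i\<in>{2..N}. - (\<gamma> i * z i))"
      by (intro sum.cong) (auto simp: w_def)
    then show ?thesis unfolding split by (simp add: w_def sum_negf)
  qed
  have w_norm: "L2_set w {1..N} \<le> 1 + sqrt (\<Sum>i\<in>{2..N}. (\<gamma> i)\<^sup>2)"
  proof -
    have "(\<Sum>i\<in>{2..N}. (w i)\<^sup>2) = (\<Sum>i\<in>{2..N}. (\<gamma> i)\<^sup>2)"
      by (intro sum.cong) (auto simp: w_def)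
    then have "L2_set w {1..N} = sqrt (1 + (\<Sum>i\<in>{2..N}. (\<gamma> i)\<^sup>2))"
      unfolding L2_set_def split by (simp add: w_def)
    also have "\<dots> \<le> sqrt 1 + sqrt (\<Sum>i\<in>{2..N}. (\<gamma> i)\<^sup>2)"
      by (intro sqrt_add_le_add_sqrt sum_nonneg) auto
    finally show ?thesis by simp
  qed
  \<comment> \<open>An event of probability one is nonempty, so some norm is at most
    \<open>\<sigma>\<close>.\<close>
  have \<sigma>: "0 \<le> \<sigma>"
  proof -
    obtain A where "A \<subseteq> {\<omega>\<in>space M. l2_norm \<mu> (\<epsilon> \<omega> 1) \<le> \<sigma>}" "prob A = 1"
      using AE_E_prob[OF eps_bdd[of 1]] N by auto
    moreover from this obtain \<omega> where "\<omega> \<in> A" by fastforce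
    ultimately have "l2_norm \<mu> (\<epsilon> \<omega> 1) \<le> \<sigma>" by auto
    then show ?thesis using l2_norm_nonneg[of \<mu> "\<epsilon> \<omega> 1"] by linarith
  qed
  obtain A where A: "A \<in> events" "1 - 2 * exp (- \<delta>\<^sup>2 / 2) \<le> prob A"
    and noise: "\<And>\<omega>. \<omega> \<in> A \<Longrightarrow>
      l2_norm \<mu> (\<lambda>x. \<Sum>i\<in>{1..N}. w i * \<epsilon> \<omega> i x) \<le> \<delta> * (\<sigma> * L2_set w {1..N})"
    using space
  proof
    assume "\<exists>a b. a < b \<and> \<mu> = lebesgue_on {a..b}"
    then obtain a b where ab: "a < b" and \<mu>: "\<mu> = lebesgue_on {a..b}" by blast
    obtain J :: "nat \<Rightarrow> nat set" and e where e: "\<And>n. l2_orthonormal \<mu> (J n) (e n)"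
      and lim: "\<And>f. f \<in> L2 \<mu> \<Longrightarrow> (\<lambda>n. \<Sum>j\<in>J n. (l2_inner \<mu> f (e n j))\<^sup>2) \<longlonglongrightarrow> (l2_norm \<mu> f)\<^sup>2"
      using lebesgue_on_orthonormal_exhaustion[OF ab] unfolding \<mu> by blast
    show thesis
      using Hoeffding_l2_norm[OF e lim finite_atLeastAtMost eps_H eps_indep eps_mean0 eps_bdd \<sigma> delta, of w]
        that by blast
  next
    assume "\<exists>d::nat. 1 \<le> d \<and> \<mu> = count_space (real ` {1..d})"
    then obtain d :: nat where \<mu>: "\<mu> = count_space (real ` {1..d})" by blast
    \<comment> \<open>On a finite set the unit vectors already recover the full norm, so the
      sequence of systems is constant.\<close>
    let ?e = "\<lambda>(_::nat) j x. if x = (j::real) then 1 else 0 :: real" and ?J = "\<lambda>_::nat. real ` {1..d}"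
    have e: "\<And>n. l2_orthonormal \<mu> (?J n) (?e n)"
      unfolding \<mu> by (rule count_space_orthonormal_exhaustion) simp
    have "(\<Sum>j\<in>?J n. (l2_inner \<mu> f (?e n j))\<^sup>2) = (l2_norm \<mu> f)\<^sup>2" for f n
      unfolding \<mu> by (rule count_space_orthonormal_exhaustion) simp
    then have lim: "\<And>f. f \<in> L2 \<mu> \<Longrightarrow> (\<lambda>n. \<Sum>j\<in>?J n. (l2_inner \<mu> f (?e n j))\<^sup>2) \<longlonglongrightarrow> (l2_norm \<mu> f)\<^sup>2"
      by simp
    show thesis
      using Hoeffding_l2_norm[OF e lim finite_atLeastAtMost eps_H eps_indep eps_mean0 eps_bdd \<sigma> delta, of w]
        that by blast
  qed
  let ?model = "\<lambda>\<omega> i x. YNT \<omega> i x = (\<Sum>t\<in>{1..T0}. l2_inner \<mu> (\<beta> t x) (YN0 i t))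
      + (\<Sum>l\<in>{1..p}. \<eta> l x * Z i l) + \<epsilon> \<omega> i x"
  \<comment> \<open>The claim must hold at every point of the event, so the almost sure statements
    on range and model are collected into one event of probability one, to be intersected with
    \<open>A\<close>.\<close>
  have "AE \<omega> in M. (\<forall>i\<in>{1..N}. YNT \<omega> i \<in> range \<Psi>) \<and> (\<forall>i\<in>{1..N}. AE x in \<mu>. ?model \<omega> i x)"
    using YNT_Y model by (intro AE_conjI AE_finite_allI) auto
  then obtain A' where A': "A' \<in> events" "prob A' = 1"
    and good: "A' \<subseteq> {\<omega>\<in>space M. (\<forall>i\<in>{1..N}. YNT \<omega> i \<in> range \<Psi>) \<and> (\<forall>i\<in>{1..N}. AE x in \<mu>. ?model \<omega> i x)}"
    by (rule AE_E_prob)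
  define D where "D t x = (\<Sum>i\<in>{1..N}. w i * YN0 i t x)" for t x
  have YN0_L2: "YN0 i t \<in> L2 \<mu>" if "i \<in> {1..N}" "t \<in> {1..T0}" for i t
    using YN0_Y[OF that] Psi_H by auto
  have D_L2: "D t \<in> L2 \<mu>" if "t \<in> {1..T0}" for t
    unfolding D_def using that by (intro L2_sum L2_cmult YN0_L2)
  define \<Delta> where "\<Delta> l = (\<Sum>i\<in>{1..N}. w i * Z i l)" for l
  define K where "K x = (\<Sum>t\<in>{1..T0}. l2_inner \<mu> (\<beta> t x) (D t))" for x
  define H where "H x = (\<Sum>l\<in>{1..p}. \<eta> l x * \<Delta> l)" for x
  note kernel = l2_norm_sum_kernel_le[where T = "{1..T0}" and \<beta> = \<beta> and g = D, OF sf finite_atLeastAtMost beta D_L2]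
  have K_L2: "K \<in> L2 \<mu>" unfolding K_def by (rule kernel(1))
  have "l2_norm \<mu> K \<le> sqrt (\<Sum>t\<in>{1..T0}. (hs_norm \<mu> (\<beta> t))\<^sup>2) * sqrt (\<Sum>t\<in>{1..T0}. (l2_norm \<mu> (D t))\<^sup>2)"
    unfolding K_def by (rule kernel(2))
  then have K_le: "l2_norm \<mu> K \<le> sqrt (\<Sum>t\<in>{1..T0}. (hs_norm \<mu> (\<beta> t))\<^sup>2)
      * sqrt (\<Sum>t\<in>{1..T0}. (l2_norm \<mu> (\<lambda>x. YN0 1 t x - (\<Sum>i\<in>{2..N}. \<gamma> i * YN0 i t x)))\<^sup>2)"
    unfolding D_def w_sum .
  have H_L2: "H \<in> L2 \<mu>"
    unfolding H_def mult.commute[of "\<eta> _ _"] by (intro L2_sum L2_cmult eta)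
  have "l2_norm \<mu> H \<le> sqrt (\<Sum>l\<in>{1..p}. (l2_norm \<mu> (\<eta> l))\<^sup>2) * sqrt (\<Sum>l\<in>{1..p}. (\<Delta> l)\<^sup>2)"
    unfolding H_def by (rule l2_norm_linear_combination_le[OF eta])
  then have H_le: "l2_norm \<mu> H \<le> sqrt (\<Sum>l\<in>{1..p}. (l2_norm \<mu> (\<eta> l))\<^sup>2)
      * sqrt (\<Sum>l\<in>{1..p}. (Z 1 l - (\<Sum>i\<in>{2..N}. \<gamma> i * Z i l))\<^sup>2)"
    unfolding \<Delta>_def w_sum .
  have sections: "AE x in \<mu>. \<forall>t\<in>{1..T0}. \<beta> t x \<in> L2 \<mu>"
    using L2_kernel_section[OF sf beta] by (intro AE_finite_allI) auto
  have bound: "dist (inv \<Psi> (YNT \<omega> 1)) (weighting_estimator \<mu> \<Psi> N \<gamma> (YNT \<omega>)) \<le>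
      l2_norm \<mu> K + l2_norm \<mu> H + \<delta> * (\<sigma> * L2_set w {1..N})" if \<omega>: "\<omega> \<in> A \<inter> A'" for \<omega>
  proof -
    have sp: "\<omega> \<in> space M" using \<omega> sets.sets_into_space[OF A(1)] by auto
    have range: "YNT \<omega> i \<in> range \<Psi>" and eq: "AE x in \<mu>. ?model \<omega> i x" if "i \<in> {1..N}" for i
      using good \<omega> that by auto
    have Y_L2: "YNT \<omega> i \<in> L2 \<mu>" if "i \<in> {1..N}" for i using range[OF that] Psi_H by auto
    let ?h = "\<lambda>x. \<Sum>i\<in>{2..N}. \<gamma> i * YNT \<omega> i x" and ?S = "\<lambda>x. \<Sum>i\<in>{1..N}. w i * \<epsilon> \<omega> i x"
    have h_L2: "?h \<in> L2 \<mu>" by (intro L2_sum L2_cmult Y_L2) auto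
    have S_L2: "?S \<in> L2 \<mu>" using sp by (intro L2_sum L2_cmult eps_H)
    have Y1: "YNT \<omega> 1 \<in> range \<Psi>" using range N by simp
    have sub: "range \<Psi> \<subseteq> L2 \<mu>" using Psi_H by auto
    have P: "l2_proj \<mu> (range \<Psi>) ?h \<in> range \<Psi>"
      using l2_proj_minimal[OF fin sub _ Y_closed Y_convex h_L2] by auto
    have "dist (inv \<Psi> (YNT \<omega> 1)) (weighting_estimator \<mu> \<Psi> N \<gamma> (YNT \<omega>)) =
        l2_norm \<mu> (\<lambda>x. YNT \<omega> 1 x - l2_proj \<mu> (range \<Psi>) ?h x)"
      unfolding weighting_estimator_def Psi_isometry f_inv_into_f[OF Y1] f_inv_into_f[OF P] ..
    also have "\<dots> \<le> l2_norm \<mu> (\<lambda>x. YNT \<omega> 1 x - ?h x)"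
      by (rule l2_proj_dist_le[OF fin sub Y_closed Y_convex h_L2 Y1])
    \<comment> \<open>Taking the \<open>w\<close>-weighted sum of the model equations turns each
      regressor into its imbalance \<open>D t\<close> or \<open>\<Delta> l\<close>. For the kernel
      terms this is linearity of the inner product, valid at those \<open>x\<close> whose sections
      lie in \<open>L2\<close>.\<close>
    also have "\<dots> = l2_norm \<mu> (\<lambda>x. (K x + H x) + ?S x)"
    proof (rule l2_norm_cong_AE)
      have "AE x in \<mu>. \<forall>i\<in>{1..N}. ?model \<omega> i x"
        using eq by (intro AE_finite_allI) auto
      then show "AE x in \<mu>. YNT \<omega> 1 x - ?h x = (K x + H x) + ?S x"
        using sections
      proof eventually_elim
        case (elim x)
        have "YNT \<omega> 1 x - ?h x = (\<Sum>i\<in>{1..N}. w i * YNT \<omega> i x)"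
          by (rule w_sum[symmetric])
        also have "\<dots> = (\<Sum>i\<in>{1..N}. (\<Sum>t\<in>{1..T0}. w i * l2_inner \<mu> (\<beta> t x) (YN0 i t))
            + (\<Sum>l\<in>{1..p}. w i * (\<eta> l x * Z i l)) + w i * \<epsilon> \<omega> i x)"
          using elim(1) by (intro sum.cong refl) (simp add: distrib_left sum_distrib_left)
        also have "\<dots> = (\<Sum>t\<in>{1..T0}. \<Sum>i\<in>{1..N}. w i * l2_inner \<mu> (\<beta> t x) (YN0 i t))
            + (\<Sum>l\<in>{1..p}. \<Sum>i\<in>{1..N}. w i * (\<eta> l x * Z i l)) + ?S x"
          by (simp only: sum.distrib sum.swap[of _ "{1..N}"])
        also have "(\<Sum>t\<in>{1..T0}. \<Sum>i\<in>{1..N}. w i * l2_inner \<mu> (\<beta> t x) (YN0 i t)) = K x"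
          unfolding K_def
        proof (rule sum.cong[OF refl])
          fix t assume t: "t \<in> {1..T0}"
          have "l2_inner \<mu> (D t) (\<beta> t x) = (\<Sum>i\<in>{1..N}. w i * l2_inner \<mu> (YN0 i t) (\<beta> t x))"
            unfolding D_def using elim(2) t YN0_L2
            by (subst l2_inner_sum_left) (auto simp: L2_cmult l2_inner_cmult_left)
          then show "(\<Sum>i\<in>{1..N}. w i * l2_inner \<mu> (\<beta> t x) (YN0 i t)) = l2_inner \<mu> (\<beta> t x) (D t)"
            by (simp add: l2_inner_commute[of _ "\<beta> t x"])
        qed
        also have "(\<Sum>l\<in>{1..p}. \<Sum>i\<in>{1..N}. w i * (\<eta> l x * Z i l)) = H x"
          by (simp add: H_def \<Delta>_def sum_distrib_left mult_ac)
        finally show ?case .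
      qed
      show "(\<lambda>x. YNT \<omega> 1 x - ?h x) \<in> borel_measurable \<mu>"
        using N by (intro L2_measurable L2_diff Y_L2 h_L2) auto
      show "(\<lambda>x. (K x + H x) + ?S x) \<in> borel_measurable \<mu>"
        by (intro L2_measurable L2_add K_L2 H_L2 S_L2)
    qed
    also have "\<dots> \<le> l2_norm \<mu> K + l2_norm \<mu> H + l2_norm \<mu> ?S"
      using l2_norm_triangle[OF L2_add[OF K_L2 H_L2] S_L2] l2_norm_triangle[OF K_L2 H_L2] by linarith
    also have "\<dots> \<le> l2_norm \<mu> K + l2_norm \<mu> H + \<delta> * (\<sigma> * L2_set w {1..N})"
      using noise[of \<omega>] \<omega> by simp
    finally show ?thesis .
  qed
  \<comment> \<open>Intersecting with an event of probability one costs nothing, so the probability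
    bound for \<open>A\<close> carries over.\<close>
  have "prob (A \<inter> A') = prob A"
    using AE_prob_1[OF A'(2)] A A' by (intro finite_measure_eq_AE) auto
  moreover have "\<delta> * (\<sigma> * L2_set w {1..N}) \<le> \<delta> * \<sigma> * (1 + sqrt (\<Sum>i\<in>{2..N}. (\<gamma> i)\<^sup>2))"
    using mult_left_mono[OF w_norm, of "\<delta> * \<sigma>"] \<sigma> delta by (simp add: mult.assoc)
  ultimately show ?thesis
    using A A' K_le H_le by (intro bexI[of _ "A \<inter> A'"] conjI ballI order_trans[OF bound] add_mono) auto
qed

end
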